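(* Fix $\alpha>0$. Let the divisor $X=\{(\lambda,m_\lambda)\}_{\lambda\in\Lambda}$ satisfy the condition $\lim_{|\lambda|\to\infty}m_\lambda=+\infty$. Then $X$ cannot be simultaneously interpolating and sampling for $\mathcal F^2_\alpha$.
   Context: $dm$ is Lebesgue area measure. For $\alpha>0$, $\mathcal F^2_\alpha$ is the Hilbert space of entire functions $f$ with $\|f\|_2^2=\frac{\alpha}{\pi}\int_{\mathbb C}|f(z)|^2e^{-\alpha|z|^2}dm(z)<\infty$, with inner product $\langle f,g\rangle=\frac{\alpha}{\pi}\int_{\mathbb C} f\overline g\, e^{-\alpha|z|^2}dm$. Its monomial orthonormal basis is $e_k(z)=\sqrt{\alpha^k/k!}\,z^k$, $k\ge 0$. For $\lambda\in\mathbb C$, the translation $T_\lambda f(\zeta)=e^{\alpha\bar\lambda\zeta-\frac{\alpha}{2}|\lambda|^2}f(\zeta-\lambda)$ acts isometrically on $\mathcal F^2_\alpha$. A divisor is $X=\{(\lambda,m_\lambda)\}_{\lambda\in\Lambda}$, where $\Lambda$ is a sequence of (distinct) points in $\mathbb C$ and $m_\lambda\in\{1,2,3,\dots\}$ is the multiplicity associated with $\lambda$. The condition $\lim_{|\lambda|\to\infty}m_\lambda=+\infty$ means: for every $M$ there is $R$ such that $m_\lambda>M$ for all $\lambda\in\Lambda$ with $|\lambda|>R$. Put $N^2_\lambda=\{f\in\mathcal F^2_\alpha: f(\lambda)=\dots=f^{(m_\lambda-1)}(\lambda)=0\}$. $X$ is called sampling for $\mathcal F^2_\alpha$ if there are constants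 $0<c\le C'<\infty$ such that for all $f\in\mathcal F^2_\alpha$, $c\|f\|_2^2\le \sum_{\lambda\in\Lambda}\|f\|^2_{\mathcal F^2_\alpha/N^2_\lambda}\le C'\|f\|_2^2$, where $\|f\|^2_{\mathcal F^2_\alpha/N^2_\lambda}=\sum_{k=0}^{m_\lambda-1}|\langle f,T_\lambda e_k\rangle|^2$ is the squared quotient norm. $X$ is called interpolating for $\mathcal F^2_\alpha$ if for every family of complex numbers $(v^{(k)}_\lambda)_{\lambda\in\Lambda,\,0\le k<m_\lambda}$ with $\sum_{\lambda\in\Lambda}\sum_{k=0}^{m_\lambda-1}|v^{(k)}_\lambda|^2<\infty$ there exists $f\in\mathcal F^2_\alpha$ such that $\langle f,T_\lambda e_k\rangle=v^{(k)}_\lambda$ for all $\lambda\in\Lambda$, $0\le k<m_\lambda$. *)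

theory Defs
  imports "HOL-Complex_Analysis.Complex_Analysis"
begin

definition fock_space :: "real \<Rightarrow> (complex \<Rightarrow> complex) set" where
  "fock_space \<alpha> = {f. f holomorphic_on UNIV \<and>
     integrable lborel (\<lambda>z. (cmod (f z))\<^sup>2 * exp (- \<alpha> * (cmod z)\<^sup>2))}"

definition fock_norm_sq :: "real \<Rightarrow> (complex \<Rightarrow> complex) \<Rightarrow> real" where
  "fock_norm_sq \<alpha> f =
     \<alpha> / pi * (LINT z|lborel. (cmod (f z))\<^sup>2 * exp (- \<alpha> * (cmod z)\<^sup>2))"

definition fock_inner :: "real \<Rightarrow> (complex \<Rightarrow> complex) \<Rightarrow> (complex \<Rightarrow> complex) \<Rightarrow> complex" where
  "fock_inner \<alpha> f g = complex_of_real (\<alpha> / pi) *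
     (LINT z|lborel. f z * cnj (g z) * complex_of_real (exp (- \<alpha> * (cmod z)\<^sup>2)))"

definition fock_basis :: "real \<Rightarrow> nat \<Rightarrow> complex \<Rightarrow> complex" where
  "fock_basis \<alpha> k z = complex_of_real (sqrt (\<alpha> ^ k / fact k)) * z ^ k"

definition fock_translation ::
    "real \<Rightarrow> complex \<Rightarrow> (complex \<Rightarrow> complex) \<Rightarrow> complex \<Rightarrow> complex" where
  "fock_translation \<alpha> l f \<zeta> =
     exp (complex_of_real \<alpha> * cnj l * \<zeta> - complex_of_real (\<alpha> / 2 * (cmod l)\<^sup>2)) * f (\<zeta> - l)"

text \<open>A divisor is given by its support, a countable (possibly finite) set of points, together
  with a multiplicity function whose values off the support are irrelevant.\<close>

definition divisor :: "complex set \<Rightarrow> (complex \<Rightarrow> nat) \<Rightarrow> bool" where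
  "divisor \<Lambda> m \<longleftrightarrow> countable \<Lambda> \<and> (\<forall>l\<in>\<Lambda>. 1 \<le> m l)"

text \<open>The squared norm of the class of \<open>f\<close> modulo the functions of the Fock space that vanish
  at \<open>l\<close> to order at least \<open>n\<close>: the translates of the first \<open>n\<close> basis functions form an
  orthonormal basis of the orthogonal complement of that subspace.\<close>

definition fock_quotient_norm_sq ::
    "real \<Rightarrow> complex \<Rightarrow> nat \<Rightarrow> (complex \<Rightarrow> complex) \<Rightarrow> real" where
  "fock_quotient_norm_sq \<alpha> l n f =
     (\<Sum>k<n. (cmod (fock_inner \<alpha> f (fock_translation \<alpha> l (fock_basis \<alpha> k))))\<^sup>2)"

text \<open>Summability is stated explicitly because \<open>infsum\<close> is 0 for families that are not summable.\<close>

definition fock_sampling :: "real \<Rightarrow> complex set \<Rightarrow> (complex \<Rightarrow> nat) \<Rightarrow> bool" where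
  "fock_sampling \<alpha> \<Lambda> m \<longleftrightarrow>
     (\<exists>c C. 0 < c \<and> c \<le> C \<and>
       (\<forall>f\<in>fock_space \<alpha>.
          (\<lambda>l. fock_quotient_norm_sq \<alpha> l (m l) f) summable_on \<Lambda> \<and>
          c * fock_norm_sq \<alpha> f \<le> (\<Sum>\<^sub>\<infinity>l\<in>\<Lambda>. fock_quotient_norm_sq \<alpha> l (m l) f) \<and>
          (\<Sum>\<^sub>\<infinity>l\<in>\<Lambda>. fock_quotient_norm_sq \<alpha> l (m l) f) \<le> C * fock_norm_sq \<alpha> f))"

definition fock_interpolating :: "real \<Rightarrow> complex set \<Rightarrow> (complex \<Rightarrow> nat) \<Rightarrow> bool" where
  "fock_interpolating \<alpha> \<Lambda> m \<longleftrightarrow>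
     (\<forall>v :: complex \<Rightarrow> nat \<Rightarrow> complex.
        (\<lambda>l. \<Sum>k<m l. (cmod (v l k))\<^sup>2) summable_on \<Lambda> \<longrightarrow>
        (\<exists>f\<in>fock_space \<alpha>. \<forall>l\<in>\<Lambda>. \<forall>k<m l.
           fock_inner \<alpha> f (fock_translation \<alpha> l (fock_basis \<alpha> k)) = v l k))"

end

theory Submission
  imports Defs "HOL-Probability.Distributions"
begin

text \<open>Attach to each point \<open>\<lambda>\<close> of the divisor the disc of centre \<open>\<lambda>\<close> and radius
  \<open>sqrt (m \<lambda> / \<alpha>)\<close>. The squared quotient norm at \<open>\<lambda>\<close> of the normalized reproducing kernel at
  \<open>w\<close> is the probability that a Poisson variable of mean \<open>\<alpha> |w - \<lambda>|\<^sup>2\<close> is less than \<open>m \<lambda>\<close>, so it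
  is close to 1 well inside the disc and close to 0 well outside. Testing the sampling inequality
  on kernels shows that the discs enlarged by a constant \<open>K\<close> cover the plane. If two discs shrunk
  by \<open>K\<close> met at \<open>w\<close>, a function interpolating the data of the kernel at one centre and zero at
  the other would have to be large and small at \<open>w\<close> simultaneously.

  The radii tend to infinity, so at scale \<open>K\<close> the discs are half planes, almost disjoint and almost
  covering. Following the boundary of a disc one meets, by connectedness, a point within \<open>O(K)\<close> of
  three discs; the directions to their centres are then pairwise almost opposite, which is
  impossible for three unit vectors.\<close>

section \<open>Planar geometry of large discs\<close>

text \<open>If the triangle inequality for \<open>norm (a - b)\<close> is nearly an equality, the
  angle between the two vectors is close to a straight one. Once all three cosines are below -1/2,
  the squared norm of the sum of the three unit vectors would be negative.\<close>

lemma three_nearly_opposite_vectors_False: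
  fixes a b c :: complex
  assumes "0 < s" and "norm a > 4 * s" "norm b > 4 * s" "norm c > 4 * s"
    and "norm a + norm b - s \<le> norm (a - b)"
    and "norm b + norm c - s \<le> norm (b - c)"
    and "norm c + norm a - s \<le> norm (c - a)"
  shows False
proof -
  \<comment> \<open>After squaring, the errors \<open>2 * s * norm x\<close> and
    \<open>2 * s * norm y\<close> are each below half of \<open>norm x * norm y\<close>, because the
    other norm exceeds \<open>4 * s\<close>; this is where the factor 4 comes from.\<close>
  have key: "2 * (sgn x \<bullet> sgn y) < - 1"
    if x: "norm x > 4 * s" and y: "norm y > 4 * s" and xy: "norm x + norm y - s \<le> norm (x - y)"
    for x y :: complex
  proof -
    have pos: "norm x > 0" "norm y > 0" using assms(1) x y by linarith+
    have "(norm x + norm y - s)\<^sup>2 \<le> (norm (x - y))\<^sup>2"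
      using xy x y assms(1) by (intro power_mono) linarith+
    also have "\<dots> = (norm x)\<^sup>2 + (norm y)\<^sup>2 - 2 * (x \<bullet> y)"
      by (simp add: power2_norm_eq_inner inner_diff_left inner_diff_right inner_commute)
    finally have "2 * (x \<bullet> y) + 2 * (norm x * norm y) \<le> 2 * s * norm x + 2 * s * norm y - s\<^sup>2"
      by (simp add: power2_eq_square algebra_simps)
    moreover have "4 * s * norm x < norm y * norm x" "4 * s * norm y < norm x * norm y"
      using x y pos by simp_all
    moreover have "s\<^sup>2 > 0" using assms(1) by (rule zero_less_power)
    moreover have "norm y * norm x = norm x * norm y" "2 * s * norm x = 4 * s * norm x / 2"
        "2 * s * norm y = 4 * s * norm y / 2" by simp_all
    ultimately have "2 * (x \<bullet> y) < - (norm x * norm y)"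
      by linarith
    then show ?thesis
      using pos by (simp add: sgn_div_norm divide_simps mult.commute)
  qed
  have "norm a > 0" "norm b > 0" "norm c > 0" using assms(1-4) by linarith+
  then have n: "sgn a \<bullet> sgn a = 1" "sgn b \<bullet> sgn b = 1" "sgn c \<bullet> sgn c = 1"
    by (simp_all add: dot_square_norm norm_sgn)
  have "0 \<le> (sgn a + sgn b + sgn c) \<bullet> (sgn a + sgn b + sgn c)" by simp
  also have "\<dots> = 3 + 2 * (sgn a \<bullet> sgn b) + 2 * (sgn b \<bullet> sgn c) + 2 * (sgn c \<bullet> sgn a)"
    using n by (simp add: inner_add_left inner_add_right inner_commute)
  finally show False
    using key[of a b] key[of b c] key[of c a] assms by linarith
qed

text \<open>Separation prevents \<open>p\<close> from lying deep inside any of the discs, so the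
  vectors from \<open>p\<close> to the centres have lengths equal to the radii up to a constant, and
  the distances between centres are nearly the sums of these lengths.\<close>

lemma three_large_discs_near_point_False:
  fixes p x y z :: complex
  assumes K: "0 < K" and D: "0 \<le> D"
    and sep: "\<And>l l'. l \<in> {x, y, z} \<Longrightarrow> l' \<in> {x, y, z} \<Longrightarrow> l \<noteq> l' \<Longrightarrow> r l + r l' - 2 * K \<le> dist l l'"
    and dist: "x \<noteq> y" "y \<noteq> z" "z \<noteq> x"
    and near: "\<And>l. l \<in> {x, y, z} \<Longrightarrow> dist p l \<le> r l + D"
    and big: "\<And>l. l \<in> {x, y, z} \<Longrightarrow> r l > 10 * (D + K)"
  shows False
proof -
  have lower: "dist p l \<ge> r l - 2 * K - D" if "l \<in> {x, y, z}" "l' \<in> {x, y, z}" "l \<noteq> l'" for l l'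
    using sep[OF that] near[OF that(2)] dist_triangle[of l l' p] by (simp add: dist_commute)
  have low: "dist p x \<ge> r x - 2 * K - D" "dist p y \<ge> r y - 2 * K - D" "dist p z \<ge> r z - 2 * K - D"
    using lower[of x y] lower[of y z] lower[of z x] dist by auto
  have up: "dist p x \<le> r x + D" "dist p y \<le> r y + D" "dist p z \<le> r z + D"
    and bigs: "r x > 10 * (D + K)" "r y > 10 * (D + K)" "r z > 10 * (D + K)"
    using near big by auto
  have seps: "r x + r y - 2 * K \<le> dist x y" "r y + r z - 2 * K \<le> dist y z" "r z + r x - 2 * K \<le> dist z x"
    using sep dist by auto
  show False
  \<comment> \<open>The defect \<open>2 * D + 2 * K\<close> collects \<open>D\<close> from each of
    two discs and \<open>2 * K\<close> from separation. The lengths exceed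
    \<open>9 * D + 8 * K\<close>, hence four times the defect; the factor 10 in \<open>big\<close>
    is chosen for this.\<close>
  proof (rule three_nearly_opposite_vectors_False[of "2 * D + 2 * K" "x - p" "y - p" "z - p"])
  qed (use K D low up bigs seps in \<open>simp_all add: dist_norm norm_minus_commute\<close>)
qed

text \<open>One member \<open>G i\<close> that meets \<open>S\<close> and the union of all the
  others are open, cover \<open>S\<close> and do not meet within \<open>S\<close>, so by
  connectedness the others miss \<open>S\<close>.\<close>

lemma connected_subset_of_disjoint_open_cover:
  fixes S :: "'a :: topological_space set"
  assumes "connected S" "S \<noteq> {}" "S \<subseteq> (\<Union>i\<in>I. G i)" "\<And>i. i \<in> I \<Longrightarrow> open (G i)"
    and disj: "\<And>i j. i \<in> I \<Longrightarrow> j \<in> I \<Longrightarrow> i \<noteq> j \<Longrightarrow> G i \<inter> G j \<inter> S = {}"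
  shows "\<exists>i\<in>I. S \<subseteq> G i"
proof -
  obtain s i where si: "s \<in> S" "i \<in> I" "s \<in> G i" using assms(2,3) by blast
  have "open (\<Union>j\<in>I - {i}. G j)" using assms(4) by auto
  moreover have "G i \<inter> (\<Union>j\<in>I - {i}. G j) \<inter> S = {}"
    using disj si(2) by blast
  moreover have "S \<subseteq> G i \<union> (\<Union>j\<in>I - {i}. G j)" using assms(3) by blast
  ultimately have "G i \<inter> S = {} \<or> (\<Union>j\<in>I - {i}. G j) \<inter> S = {}"
    using connectedD[OF assms(1), of "G i" "\<Union>j\<in>I - {i}. G j"] assms(4) si(2) by auto
  then show ?thesis using si assms(3) by blast
qed

lemma infinite_three_distinct:
  assumes "infinite A"
  obtains x y z where "x \<in> A" "y \<in> A" "z \<in> A" "x \<noteq> y" "y \<noteq> z" "z \<noteq> x"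
proof -
  obtain x where x: "x \<in> A" using assms by (metis finite.emptyI ex_in_conv)
  obtain y where y: "y \<in> A - {x}" using assms by (metis finite.emptyI ex_in_conv infinite_remove)
  obtain z where z: "z \<in> A - {x, y}"
    using assms by (metis Diff_infinite_finite finite.emptyI finite.insertI ex_in_conv)
  show ?thesis using that[of x y z] x y z by blast
qed

text \<open>The geometric half of the argument: \<open>cover\<close> will come from sampling,
  \<open>sep\<close> from interpolation combined with sampling, and \<open>fin\<close> from the
  growth of the multiplicities. On a circle just outside one large disc the other enlarged discs
  form an open cover with disjoint traces, so a single disc swallows the circle and violates
  separation.\<close>

lemma no_large_disc_tiling:
  fixes \<Lambda> :: "complex set" and r :: "complex \<Rightarrow> real"
  assumes K: "0 < K" and r0: "\<And>l. l \<in> \<Lambda> \<Longrightarrow> 0 \<le> r l"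
    and cover: "\<And>p. \<exists>l\<in>\<Lambda>. dist p l \<le> r l + K"
    and sep: "\<And>l l'. l \<in> \<Lambda> \<Longrightarrow> l' \<in> \<Lambda> \<Longrightarrow> l \<noteq> l' \<Longrightarrow> K \<le> r l \<Longrightarrow> K \<le> r l'
              \<Longrightarrow> r l + r l' - 2 * K \<le> dist l l'"
    and fin: "\<And>\<rho>. finite {l\<in>\<Lambda>. r l \<le> \<rho>}"
  shows False
proof -
  have inf: "infinite \<Lambda>"
  proof
    assume "finite \<Lambda>"
    then have "bounded (\<Union>l\<in>\<Lambda>. cball l (r l + K))" by auto
    moreover have "UNIV \<subseteq> (\<Union>l\<in>\<Lambda>. cball l (r l + K))"
      using cover by (auto simp: dist_commute)
    ultimately show False by (metis bounded_subset not_bounded_UNIV)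
  qed
  \<comment> \<open>The threshold is \<open>10 * (D + K)\<close> with \<open>D = 2 * K\<close>, as
    required when three discs are compared at a point of the circle \<open>S\<close> below.\<close>
  define small where "small = {l\<in>\<Lambda>. r l \<le> 30 * K}"
  have "bounded (\<Union>l\<in>small. ball l (r l + 2 * K))"
    using fin by (auto simp: small_def)
  then obtain \<rho> where \<rho>: "\<rho> > 0" "\<And>p. p \<in> (\<Union>l\<in>small. ball l (r l + 2 * K)) \<Longrightarrow> norm p \<le> \<rho>"
    unfolding bounded_pos by blast
  \<comment> \<open>The threshold is again \<open>10 * (D + K)\<close>, now for the point 0 with
    \<open>D = \<rho> + 3 * K\<close>.\<close>
  define B where "B = {l\<in>\<Lambda>. r l > 10 * (\<rho> + 3 * K + K)}"
  have "B = \<Lambda> - {l\<in>\<Lambda>. r l \<le> 10 * (\<rho> + 3 * K + K)}" by (auto simp: B_def)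
  then have "infinite B" using inf fin Diff_infinite_finite by metis
  then obtain x y z where xyz: "x \<in> B" "y \<in> B" "z \<in> B" "x \<noteq> y" "y \<noteq> z" "z \<noteq> x"
    by (rule infinite_three_distinct)
  \<comment> \<open>Some large disc stays away from all small ones: otherwise three large discs pass near 0.\<close>
  have "\<exists>l\<in>{x, y, z}. norm l > r l + (\<rho> + 3 * K)"
  proof (rule ccontr)
    assume "\<not> ?thesis"
    then have near: "dist 0 l \<le> r l + (\<rho> + 3 * K)" if "l \<in> {x, y, z}" for l
      using that by force
    show False
    proof (rule three_large_discs_near_point_False[OF K, of "\<rho> + 3 * K" x y z r 0])
      show "r l + r l' - 2 * K \<le> dist l l'"
        if "l \<in> {x, y, z}" "l' \<in> {x, y, z}" "l \<noteq> l'" for l l'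
        using that xyz K \<rho>(1) unfolding B_def by (intro sep) auto
    qed (use near xyz K \<rho>(1) in \<open>auto simp: B_def\<close>)
  qed
  then obtain l0 where l0: "l0 \<in> \<Lambda>" "norm l0 > r l0 + \<rho> + 3 * K" "r l0 > 30 * K"
    using xyz K \<rho>(1) unfolding B_def by fastforce
  \<comment> \<open>With the margin \<open>2 * K\<close>, the circle lies outside the disc of
    \<open>l0\<close> enlarged by \<open>K\<close>, so \<open>cover\<close> must supply another disc
    at each of its points. The choice of \<open>l0\<close> keeps the circle outside the ball of
    radius \<rho> that holds the small discs.\<close>
  define S where "S = sphere l0 (r l0 + 2 * K)"
  have S_big: "r l > 30 * K" if "p \<in> S" "l \<in> \<Lambda>" "dist l p < r l + 2 * K" for p l
  proof (rule ccontr)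
    assume "\<not> r l > 30 * K"
    then have "p \<in> (\<Union>l\<in>small. ball l (r l + 2 * K))" using that by (auto simp: small_def)
    then have "norm p \<le> \<rho>" using \<rho>(2) by blast
    moreover have "norm l0 \<le> norm p + dist l0 p" by (metis dist_norm norm_triangle_sub)
    moreover have "dist l0 p = r l0 + 2 * K" using that(1) by (simp add: S_def)
    ultimately show False using l0(2) K by linarith
  qed
  have sepbig: "r l + r l' - 2 * K \<le> dist l l'"
    if "l \<in> \<Lambda>" "l' \<in> \<Lambda>" "l \<noteq> l'" "r l > 30 * K" "r l' > 30 * K" for l l'
    using that K by (intro sep) auto
  \<comment> \<open>A point of \<open>S\<close> in two of the enlarged discs is near three discs, so by connectedness one disc
    would contain the whole circle \<open>S\<close>.\<close>
  have "\<exists>l\<in>\<Lambda> - {l0}. S \<subseteq> ball l (r l + 2 * K)"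
  proof (rule connected_subset_of_disjoint_open_cover)
    show "connected S" unfolding S_def by (intro connected_sphere) simp
    show "S \<noteq> {}" unfolding S_def using l0(3) K by simp
    show "S \<subseteq> (\<Union>l\<in>\<Lambda> - {l0}. ball l (r l + 2 * K))"
    proof
      fix p assume p: "p \<in> S"
      obtain l where l: "l \<in> \<Lambda>" "dist p l \<le> r l + K" using cover by blast
      then have "l \<noteq> l0" using p K by (auto simp: S_def dist_commute)
      then show "p \<in> (\<Union>l\<in>\<Lambda> - {l0}. ball l (r l + 2 * K))"
        using l K by (auto simp: dist_commute intro!: bexI[of _ l])
    qed
    show "ball l (r l + 2 * K) \<inter> ball l' (r l' + 2 * K) \<inter> S = {}"
      if ll: "l \<in> \<Lambda> - {l0}" "l' \<in> \<Lambda> - {l0}" "l \<noteq> l'" for l l'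
    proof (rule ccontr)
      assume "\<not> ?thesis"
      then obtain p where p: "dist l p < r l + 2 * K" "dist l' p < r l' + 2 * K" "p \<in> S" by auto
      have big: "r l > 30 * K" "r l' > 30 * K" using S_big p ll by auto
      show False
      proof (rule three_large_discs_near_point_False[OF K, of "2 * K" l0 l l' r p])
        show "r k + r k' - 2 * K \<le> dist k k'"
          if "k \<in> {l0, l, l'}" "k' \<in> {l0, l, l'}" "k \<noteq> k'" for k k'
          using that ll big l0 by (intro sepbig) auto
        show "dist p k \<le> r k + 2 * K" if "k \<in> {l0, l, l'}" for k
          using that p by (auto simp: S_def dist_commute)
      qed (use K ll big l0 in auto)
    qed
  qed auto
  then obtain l where l: "l \<in> \<Lambda>" "l \<noteq> l0" "S \<subseteq> ball l (r l + 2 * K)" by blast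
  \<comment> \<open>The point of \<open>S\<close> farthest from \<open>l\<close>. That it lies in
    the disc around \<open>l\<close> gives \<open>norm (l0 - l) + r l0 < r l\<close>, which with
    separation would force \<open>r l0 < K\<close>.\<close>
  define p where "p = l0 + (r l0 + 2 * K) *\<^sub>R sgn (l0 - l)"
  have n: "norm (sgn (l0 - l)) = 1" using l(2) by (simp add: norm_sgn)
  then have pS: "p \<in> S" using l0(3) K by (simp add: p_def S_def dist_norm)
  have "p - l = (norm (l0 - l) + r l0 + 2 * K) *\<^sub>R sgn (l0 - l)"
    using l(2) by (simp add: p_def algebra_simps sgn_div_norm)
  then have "dist p l = norm (l0 - l) + r l0 + 2 * K"
    using n l0(3) K by (simp add: dist_norm)
  then have "norm (l0 - l) + r l0 < r l" using l(3) pS by (auto simp: dist_commute)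
  moreover have "r l > 30 * K" using S_big[OF pS l(1)] l(3) pS by auto
  then have "r l0 + r l - 2 * K \<le> norm (l0 - l)"
    using sepbig[of l0 l] l l0 by (simp add: dist_norm)
  ultimately show False using l0(3) K by linarith
qed

section \<open>Rotations and radial integrals\<close>

text \<open>Carries Lebesgue measure over to \<open>real^2\<close>, where the image of a measurable
  set under an orthogonal transformation is known to keep its measure.\<close>

lemma lborel_complex_eq_distr_vec2:
  "(lborel :: complex measure) = distr lborel borel (\<lambda>v :: real^2. Complex (v $ 1) (v $ 2))"
proof (rule lborel_eqI)
  fix l u :: complex assume le: "\<And>b. b \<in> Basis \<Longrightarrow> l \<bullet> b \<le> u \<bullet> b"
  have le': "Re l \<le> Re u" "Im l \<le> Im u"
    using le[of 1] le[of \<i>] by (simp_all add: Basis_complex_def)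
  have [measurable]: "(\<lambda>v :: real^2. Complex (v $ 1) (v $ 2)) \<in> borel_measurable borel"
    by (intro borel_measurable_continuous_onI continuous_intros)
  have B2: "(Basis :: (real^2) set) = {axis 1 1, axis 2 1}"
    by (auto simp: Basis_vec_def UNIV_2)
  have neq: "axis 1 1 \<noteq> (axis 2 1 :: real^2)" by (simp add: axis_eq_axis)
  have vim: "(\<lambda>v :: real^2. Complex (v $ 1) (v $ 2)) -` box l u
      = box (vector [Re l, Im l]) (vector [Re u, Im u])"
    by (auto simp: box_def Basis_complex_def B2 inner_axis)
  have "emeasure (distr lborel borel (\<lambda>v :: real^2. Complex (v $ 1) (v $ 2))) (box l u)
      = emeasure lborel (box (vector [Re l, Im l]) (vector [Re u, Im u] :: real^2))"
    by (simp add: emeasure_distr vim)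
  also have "\<dots> = ennreal (\<Prod>b\<in>Basis. (vector [Re u, Im u] - vector [Re l, Im l] :: real^2) \<bullet> b)"
    using le' by (intro emeasure_lborel_box) (auto simp: B2 inner_axis)
  also have "\<dots> = ennreal ((Re u - Re l) * (Im u - Im l))"
    using neq by (simp add: B2 inner_axis)
  also have "\<dots> = (\<Prod>b\<in>Basis. (u - l) \<bullet> b)"
    by (simp add: Basis_complex_def)
  finally show "emeasure (distr lborel borel (\<lambda>v :: real^2. Complex (v $ 1) (v $ 2))) (box l u)
      = (\<Prod>b\<in>Basis. (u - l) \<bullet> b)" .
qed simp

text \<open>In coordinates, the preimage of a box under multiplication by \<open>w\<close> is its
  image under multiplication by \<open>cnj w\<close>, which is orthogonal because
  \<open>cmod w = 1\<close>. Agreement on boxes determines the measure.\<close>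

lemma lborel_distr_complex_rotation:
  fixes w :: complex
  assumes w: "cmod w = 1"
  shows "distr lborel borel (\<lambda>z. w * z) = lborel"
proof (rule lborel_eqI[symmetric])
  fix l u :: complex assume le: "\<And>b. b \<in> Basis \<Longrightarrow> l \<bullet> b \<le> u \<bullet> b"
  define \<phi> where "\<phi> = (\<lambda>v :: real^2. Complex (v $ 1) (v $ 2))"
  define T where "T = (\<lambda>v :: real^2. vector [Re (cnj w * \<phi> v), Im (cnj w * \<phi> v)] :: real^2)"
  define B where "B = \<phi> -` box l u"
  have [measurable]: "\<phi> \<in> borel_measurable borel" unfolding \<phi>_def
    by (intro borel_measurable_continuous_onI continuous_intros)
  have T: "orthogonal_transformation T"
    unfolding orthogonal_transformation
  proof
    show "linear T"
      by (rule linearI) (auto simp: T_def \<phi>_def vec_eq_iff forall_2 algebra_simps)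
    have "(norm (T v))\<^sup>2 = (norm v)\<^sup>2" for v
    proof -
      have "(norm (T v))\<^sup>2 = (cmod (cnj w * \<phi> v))\<^sup>2"
        unfolding cmod_power2 by (simp add: T_def norm_vec_def L2_set_def sum_2)
      also have "\<dots> = (cmod (\<phi> v))\<^sup>2"
        using w by (simp add: norm_mult)
      also have "\<dots> = (norm v)\<^sup>2"
        unfolding cmod_power2 by (simp add: \<phi>_def norm_vec_def L2_set_def sum_2)
      finally show ?thesis .
    qed
    then show "\<forall>v. norm (T v) = norm v" by simp
  qed
  have ww: "cnj w * w = 1" using w by (metis complex_norm_square mult.commute of_real_1 one_power2)
  have im: "\<phi> -` ((\<lambda>z. w * z) -` box l u) = T ` B"
  proof (intro equalityI subsetI)
    fix v assume v: "v \<in> \<phi> -` ((\<lambda>z. w * z) -` box l u)"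
    let ?x = "vector [Re (w * \<phi> v), Im (w * \<phi> v)] :: real^2"
    have px: "\<phi> ?x = w * \<phi> v" by (simp add: \<phi>_def complex_eq_iff)
    have "cnj w * \<phi> ?x = \<phi> v" by (simp only: px mult.assoc[symmetric] ww mult_1)
    then have "T ?x = v" unfolding T_def by (simp only:) (simp add: vec_eq_iff forall_2 \<phi>_def)
    moreover have "?x \<in> B" using v px by (simp add: B_def)
    ultimately show "v \<in> T ` B" by force
  next
    fix v assume "v \<in> T ` B"
    then obtain x where x: "x \<in> B" "v = T x" by blast
    have "\<phi> (T x) = cnj w * \<phi> x" by (simp add: \<phi>_def T_def complex_eq_iff)
    then have "w * \<phi> v = \<phi> x" using ww x(2) by (simp add: mult.assoc[symmetric] mult.commute)
    then show "v \<in> \<phi> -` ((\<lambda>z. w * z) -` box l u)" using x by (simp add: B_def)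
  qed
  have em: "emeasure lborel (box l u) = emeasure lborel B"
    by (subst lborel_complex_eq_distr_vec2) (simp add: B_def \<phi>_def[symmetric] emeasure_distr)
  have Bm[measurable]: "B \<in> sets borel" unfolding B_def
    using measurable_sets_borel[of \<phi> borel "box l u"] by simp
  have Bfin: "emeasure lborel B < \<infinity>" using em emeasure_lborel_box_finite[of l u] by simp
  then have Blm: "B \<in> lmeasurable" by (intro fmeasurableI) auto
  have TBm: "T ` B \<in> sets borel" unfolding im[symmetric]
    using measurable_sets_borel[of "\<lambda>v. w * \<phi> v" borel "box l u"] by (simp add: vimage_def)
  have TB: "T ` B \<in> lmeasurable" "measure lebesgue (T ` B) = measure lebesgue B"
    using measurable_orthogonal_image[OF T Blm] measure_orthogonal_image[OF T Blm] by auto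
  have "emeasure (distr lborel borel (\<lambda>z. w * z)) (box l u) = emeasure lborel ((\<lambda>z. w * z) -` box l u)"
    by (simp add: emeasure_distr)
  also have "\<dots> = emeasure lborel (T ` B)"
    by (subst lborel_complex_eq_distr_vec2)
       (simp add: im[symmetric] \<phi>_def[symmetric] emeasure_distr vimage_def)
  also have "\<dots> = emeasure lebesgue (T ` B)" using TBm by simp
  also have "\<dots> = emeasure lebesgue B"
    using TB Blm by (simp add: emeasure_eq_measure2)
  also have "\<dots> = emeasure lborel (box l u)" using em by simp
  also have "\<dots> = (\<Prod>b\<in>Basis. (u - l) \<bullet> b)"
    using le by simp
  finally show "emeasure (distr lborel borel (\<lambda>z. w * z)) (box l u) = (\<Prod>b\<in>Basis. (u - l) \<bullet> b)" .
qed simp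

text \<open>Polar coordinates for radial functions: the disc of radius \<open>sqrt a\<close> has
  area \<open>pi * a\<close>, so both measures agree on the half lines \<open>{..a}\<close>, an
  intersection-stable generator of the Borel sets.\<close>

lemma lborel_distr_cmod_square:
  "distr lborel borel (\<lambda>z::complex. (cmod z)\<^sup>2) = density lborel (\<lambda>t. ennreal pi * indicator {0..} t)"
proof (rule measure_eqI_generator_eq[where \<Omega>=UNIV and E="range (\<lambda>a::real. {..a})" and A="\<lambda>n. {..real n}"])
  show "Int_stable (range (\<lambda>a::real. {..a}))" by (auto simp: Int_stable_def)
  have eq: "emeasure (distr lborel borel (\<lambda>z::complex. (cmod z)\<^sup>2)) {..a}
     = ennreal (if 0 \<le> a then pi * a else 0)" for a
  proof (cases "0 \<le> a")
    case True
    have "{z::complex. (cmod z)\<^sup>2 \<le> a} = cball 0 (sqrt a)"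
      using True by (auto simp: real_le_rsqrt real_sqrt_le_iff dest: sqrt_ge_absD) (simp add: real_sqrt_unique sqrt_ge_absD abs_le_square_iff real_le_rsqrt)
    then show ?thesis using True
      by (simp add: emeasure_distr vimage_def emeasure_cball unit_ball_vol_2)
  next
    case False
    then have "{z::complex. (cmod z)\<^sup>2 \<le> a} = {}" by (auto simp: not_le intro: less_le_trans)
    then show ?thesis using False by (simp add: emeasure_distr vimage_def)
  qed
  have eq2: "emeasure (density lborel (\<lambda>t. ennreal pi * indicator {0..} t)) {..a}
     = ennreal (if 0 \<le> a then pi * a else 0)" for a
  proof -
    have "emeasure (density lborel (\<lambda>t. ennreal pi * indicator {0..} t)) {..a}
        = (\<integral>\<^sup>+ t. ennreal pi * indicator {0..a} t \<partial>lborel)"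
      by (subst emeasure_density) (auto intro!: nn_integral_cong split: split_indicator)
    also have "\<dots> = ennreal pi * emeasure lborel {0..a}"
      by (simp add: nn_integral_cmult)
    also have "\<dots> = ennreal (if 0 \<le> a then pi * a else 0)"
      by (auto simp: ennreal_mult)
    finally show ?thesis .
  qed
  show "emeasure (distr lborel borel (\<lambda>z::complex. (cmod z)\<^sup>2)) X
      = emeasure (density lborel (\<lambda>t. ennreal pi * indicator {0..} t)) X"
    if "X \<in> range (\<lambda>a::real. {..a})" for X
    using that eq eq2 by auto
  show "emeasure (distr lborel borel (\<lambda>z::complex. (cmod z)\<^sup>2)) {..real n} \<noteq> \<infinity>" for n
    using eq[of "real n"] by simp
  show "(\<Union>n. {..real n}) = UNIV" using real_arch_simple by auto
qed (auto simp: borel_eq_atMost)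

text \<open>With \<open>t\<close> for the squared modulus, the integral becomes
  \<open>pi / \<alpha>\<close> times the k-th moment of the exponential law, which is
  \<open>erlang_density 0 \<alpha>\<close>.\<close>

lemma
  fixes \<alpha> :: real
  assumes \<alpha>: "0 < \<alpha>"
  shows integrable_power_cmod_gauss:
      "integrable lborel (\<lambda>z::complex. (cmod z) ^ (2 * k) * exp (- \<alpha> * (cmod z)\<^sup>2))"
    and integral_power_cmod_gauss:
      "(LINT z::complex|lborel. (cmod z) ^ (2 * k) * exp (- \<alpha> * (cmod z)\<^sup>2)) = pi * fact k / \<alpha> ^ Suc k"
proof -
  have "has_bochner_integral lborel (\<lambda>z::complex. (cmod z) ^ (2 * k) * exp (- \<alpha> * (cmod z)\<^sup>2))
     (pi * fact k / \<alpha> ^ Suc k)"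
  proof (rule has_bochner_integral_nn_integral)
    have "(\<integral>\<^sup>+ z. ennreal ((cmod z) ^ (2 * k) * exp (- \<alpha> * (cmod z)\<^sup>2)) \<partial>lborel)
       = (\<integral>\<^sup>+ t. ennreal (t ^ k * exp (- \<alpha> * t)) \<partial>distr lborel borel (\<lambda>z::complex. (cmod z)\<^sup>2))"
      by (subst nn_integral_distr) (simp_all add: power_mult)
    also have "\<dots> = (\<integral>\<^sup>+ t. ennreal (pi / \<alpha>) * ennreal (erlang_density 0 \<alpha> t * t ^ k) \<partial>lborel)"
      unfolding lborel_distr_cmod_square using \<alpha>
      by (subst nn_integral_density)
         (auto intro!: nn_integral_cong simp: erlang_density_def ennreal_mult'[symmetric] mult_ac split: split_indicator)
    also have "\<dots> = ennreal (pi / \<alpha>) * ennreal (fact k / \<alpha> ^ k)"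
      using \<alpha> nn_integral_erlang_ith_moment[of \<alpha> 0 k] by (subst nn_integral_cmult) auto
    also have "\<dots> = ennreal (pi * fact k / \<alpha> ^ Suc k)"
      using \<alpha> by (simp add: ennreal_mult'[symmetric])
    finally show "(\<integral>\<^sup>+ z. ennreal ((cmod z) ^ (2 * k) * exp (- \<alpha> * (cmod z)\<^sup>2)) \<partial>lborel)
       = ennreal (pi * fact k / \<alpha> ^ Suc k)" .
  qed (use \<alpha> in auto)
  then show "integrable lborel (\<lambda>z::complex. (cmod z) ^ (2 * k) * exp (- \<alpha> * (cmod z)\<^sup>2))"
    "(LINT z::complex|lborel. (cmod z) ^ (2 * k) * exp (- \<alpha> * (cmod z)\<^sup>2)) = pi * fact k / \<alpha> ^ Suc k"
    by (auto simp: has_bochner_integral_iff)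
qed

section \<open>Orthogonality of monomials and Taylor coefficients as integrals\<close>

lemma integral_complex_rotation:
  fixes h :: "complex \<Rightarrow> complex"
  assumes "cmod w = 1" and [measurable]: "h \<in> borel_measurable borel"
  shows "(LINT z|lborel. h (w * z)) = (LINT z|lborel. h z)"
proof -
  have "(LINT z|lborel. h z) = (LINT z|distr lborel borel (\<lambda>z. w * z). h z)"
    using lborel_distr_complex_rotation[OF assms(1)] by simp
  also have "\<dots> = (LINT z|lborel. h (w * z))" by (subst integral_distr) simp_all
  finally show ?thesis ..
qed

text \<open>A suitable rotation preserves the measure and the radial weight but changes the sign of
  the monomial factor, so the integral equals its own negative.\<close>

lemma integral_rotation_character_eq_0:
  fixes \<rho> :: "complex \<Rightarrow> real"
  assumes jk: "j \<noteq> k" and [measurable]: "\<rho> \<in> borel_measurable borel"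
    and radial: "\<And>w z. cmod w = 1 \<Longrightarrow> \<rho> (w * z) = \<rho> z"
  shows "(LINT z|lborel. \<rho> z *\<^sub>R (z ^ j * cnj z ^ k)) = (0::complex)"
proof -
  \<comment> \<open>rotation by this angle changes the sign of \<open>z ^ j * cnj z ^ k\<close>\<close>
  define w where "w = cis (pi / (real j - real k))"
  have w: "w ^ j * cnj w ^ k = - 1"
  proof -
    have "w ^ j * cnj w ^ k = cis (real j * (pi / (real j - real k)) - real k * (pi / (real j - real k)))"
      by (simp add: w_def cis_cnj Complex.DeMoivre cis_mult algebra_simps)
    also have "real j * (pi / (real j - real k)) - real k * (pi / (real j - real k)) = pi"
      using jk by (simp only: left_diff_distrib[symmetric]) simp
    finally show ?thesis by simp
  qed
  have w1: "cmod w = 1" by (simp add: w_def)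
  have "(LINT z|lborel. \<rho> z *\<^sub>R (z ^ j * cnj z ^ k))
      = (LINT z|lborel. \<rho> (w * z) *\<^sub>R ((w * z) ^ j * cnj (w * z) ^ k))"
    by (rule integral_complex_rotation[symmetric, OF w1])
       (intro borel_measurable_scaleR assms(2) borel_measurable_continuous_onI continuous_intros)
  also have "\<dots> = (LINT z|lborel. - (\<rho> z *\<^sub>R (z ^ j * cnj z ^ k)))"
  proof (rule Bochner_Integration.integral_cong[OF refl])
    fix z :: complex
    have "(w * z) ^ j * cnj (w * z) ^ k = (w ^ j * cnj w ^ k) * (z ^ j * cnj z ^ k)"
      by (simp add: power_mult_distrib)
    then show "\<rho> (w * z) *\<^sub>R ((w * z) ^ j * cnj (w * z) ^ k) = - (\<rho> z *\<^sub>R (z ^ j * cnj z ^ k))"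
      using radial[OF w1] by (simp add: w)
  qed
  finally show ?thesis by simp
qed

lemma integral_cball_tendsto:
  fixes h :: "complex \<Rightarrow> 'b :: {banach, second_countable_topology}"
  assumes "integrable lborel h"
  shows "(\<lambda>n. LINT z|lborel. indicator (cball 0 (real n)) z *\<^sub>R h z) \<longlonglongrightarrow> (LINT z|lborel. h z)"
proof (rule integral_dominated_convergence[where w="\<lambda>z. norm (h z)"])
  have [measurable]: "h \<in> borel_measurable borel" using borel_measurable_integrable[OF assms] by simp
  show "AE z in lborel. (\<lambda>n. indicator (cball 0 (real n)) z *\<^sub>R h z) \<longlonglongrightarrow> h z"
  proof (rule AE_I2, rule tendsto_eventually)
    fix z :: complex
    show "\<forall>\<^sub>F n in sequentially. indicator (cball 0 (real n)) z *\<^sub>R h z = h z"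
      using eventually_ge_at_top[of "nat \<lceil>cmod z\<rceil>"]
      by eventually_elim (simp add: nat_le_iff ceiling_le_iff)
  qed
  show "h \<in> borel_measurable lborel" by simp
  show "(\<lambda>z. indicator (cball 0 (real n)) z *\<^sub>R h z) \<in> borel_measurable lborel" for n
    by (intro borel_measurable_scaleR borel_measurable_indicator) simp_all
qed (use assms in \<open>auto split: split_indicator\<close>)

text \<open>The cut-off to a disc supplies a summable majorant, \<open>norm (b j) * R ^ j\<close>
  times a fixed integrable function. The series may therefore be integrated term by term, and
  rotation kills every term except \<open>j = k\<close>.\<close>

lemma integral_cball_power_series_times_cnj_power:
  fixes g :: "complex \<Rightarrow> complex" and b :: "nat \<Rightarrow> complex"
  assumes sums: "\<And>z. (\<lambda>j. b j * z ^ j) sums g z" and R: "0 < R"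
  shows "(LINT z|lborel. indicator (cball 0 R) z *\<^sub>R (g z * cnj z ^ k * complex_of_real (exp (- \<alpha> * (cmod z)\<^sup>2))))
    = b k * (LINT z|lborel. indicator (cball 0 R) z *\<^sub>R complex_of_real (cmod z ^ (2 * k) * exp (- \<alpha> * (cmod z)\<^sup>2)))"
    (is "?L = b k * ?M")
proof -
  define \<rho> where "\<rho> = (\<lambda>z::complex. indicator (cball 0 R) z * exp (- \<alpha> * (cmod z)\<^sup>2))"
  have [measurable]: "\<rho> \<in> borel_measurable borel"
    unfolding \<rho>_def by (intro borel_measurable_times borel_measurable_indicator) simp_all
  define f where "f = (\<lambda>j z. b j * (\<rho> z *\<^sub>R (z ^ j * cnj z ^ k)))"
  have int0: "integrable lborel (\<lambda>z. \<rho> z *\<^sub>R (z ^ j * cnj z ^ k))" for j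
  proof -
    have "integrable lborel (\<lambda>z. indicator (cball 0 R) z *\<^sub>R (exp (- \<alpha> * (cmod z)\<^sup>2) *\<^sub>R (z ^ j * cnj z ^ k)))"
      by (rule borel_integrable_compact) (auto intro!: continuous_intros)
    then show ?thesis by (simp add: \<rho>_def)
  qed
  define B where "B = (LINT z|lborel. \<rho> z * R ^ k)"
  have \<rho>int: "integrable lborel (\<lambda>z. \<rho> z * R ^ k)"
  proof -
    have "integrable lborel (\<lambda>z::complex. indicator (cball 0 R) z *\<^sub>R (exp (- \<alpha> * (cmod z)\<^sup>2) * R ^ k))"
      by (rule borel_integrable_compact) (auto intro!: continuous_intros)
    then show ?thesis by (simp add: \<rho>_def mult.assoc)
  qed
  have bound: "norm (f j z) \<le> norm (b j) * R ^ j * (\<rho> z * R ^ k)" for j z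
  proof (cases "cmod z \<le> R")
    case True
    have "cmod z ^ j * cmod z ^ k \<le> R ^ j * R ^ k"
      using True by (intro mult_mono power_mono) (use R in auto)
    then have "norm (b j) * (\<rho> z * (cmod z ^ j * cmod z ^ k)) \<le> norm (b j) * (\<rho> z * (R ^ j * R ^ k))"
      by (intro mult_left_mono) (auto simp: \<rho>_def)
    then show ?thesis
      using True by (simp add: f_def norm_mult norm_power \<rho>_def abs_mult mult_ac)
  qed (simp add: f_def \<rho>_def)
  \<comment> \<open>Convergence at the larger radius \<open>R + 1\<close> gives absolute convergence
    at \<open>R\<close>.\<close>
  have sm: "summable (\<lambda>j. norm (b j) * R ^ j)"
  proof -
    have "summable (\<lambda>j. b j * (of_real (R + 1) :: complex) ^ j)" using sums sums_summable by blast
    then have "summable (\<lambda>j. norm (b j * (of_real R :: complex) ^ j))"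
      by (rule powser_insidea) (use R in simp)
    then show ?thesis using R by (simp add: norm_mult norm_power)
  qed
  have fint: "integrable lborel (f j)" for j
    unfolding f_def by (intro integrable_mult_right int0)
  have fsums: "(\<lambda>j. LINT z|lborel. f j z) sums (LINT z|lborel. (\<Sum>j. f j z))"
  proof (rule sums_integral)
    show "integrable lborel (f j)" for j by (rule fint)
    show "AE z in lborel. summable (\<lambda>j. norm (f j z))"
    proof (rule AE_I2)
      fix z :: complex
      show "summable (\<lambda>j. norm (f j z))"
        by (rule summable_comparison_test'[OF summable_mult2[OF sm, of "\<rho> z * R ^ k"], of 0])
           (use bound in simp)
    qed
    show "summable (\<lambda>j. LINT z|lborel. norm (f j z))"
    proof (rule summable_comparison_test'[OF summable_mult2[OF sm, of B], of 0])
      fix j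
      have "(LINT z|lborel. norm (f j z)) \<le> (LINT z|lborel. norm (b j) * R ^ j * (\<rho> z * R ^ k))"
        by (intro integral_mono integrable_norm fint integrable_mult_right \<rho>int bound)
      also have "\<dots> = norm (b j) * R ^ j * B" using \<rho>int by (simp add: B_def)
      finally show "norm (LINT z|lborel. norm (f j z)) \<le> norm (b j) * R ^ j * B" by simp
    qed
  qed
  have zero: "(LINT z|lborel. f j z) = 0" if "j \<noteq> k" for j
  proof -
    have "(LINT z|lborel. \<rho> z *\<^sub>R (z ^ j * cnj z ^ k)) = 0"
      by (rule integral_rotation_character_eq_0[OF that])
         (auto simp: \<rho>_def norm_mult indicator_def)
    then show ?thesis by (simp only: f_def integral_mult_right_zero mult_zero_right)
  qed
  then have "(\<lambda>j. LINT z|lborel. f j z) = (\<lambda>j. if j = k then LINT z|lborel. f j z else 0)"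
    by (intro ext) (simp del: integral_mult_right_zero)
  then have "(\<lambda>j. LINT z|lborel. f j z) sums (LINT z|lborel. f k z)"
    using sums_single[of k "\<lambda>j. LINT z|lborel. f j z"] by simp
  then have "(LINT z|lborel. (\<Sum>j. f j z)) = (LINT z|lborel. f k z)"
    using fsums sums_unique2 by blast
  moreover have "(LINT z|lborel. (\<Sum>j. f j z)) = ?L"
  proof (rule Bochner_Integration.integral_cong[OF refl])
    fix z :: complex
    have "(\<lambda>j. (b j * z ^ j) * (\<rho> z *\<^sub>R cnj z ^ k)) sums (g z * (\<rho> z *\<^sub>R cnj z ^ k))"
      by (rule sums_mult2[OF sums])
    then have "(\<Sum>j. f j z) = g z * (\<rho> z *\<^sub>R cnj z ^ k)"
      by (simp add: f_def sums_iff scaleR_conv_of_real mult_ac)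
    then show "(\<Sum>j. f j z) = indicator (cball 0 R) z *\<^sub>R (g z * cnj z ^ k * complex_of_real (exp (- \<alpha> * (cmod z)\<^sup>2)))"
      by (simp add: \<rho>_def scaleR_conv_of_real mult_ac)
  qed
  moreover have "(LINT z|lborel. f k z) = b k * ?M"
  proof -
    have zk: "z ^ k * cnj z ^ k = complex_of_real (cmod z ^ (2 * k))" for z
      by (simp only: power_mult_distrib[symmetric] complex_norm_square[symmetric] power_mult of_real_power)
    have "f k = (\<lambda>z. b k * (indicator (cball 0 R) z *\<^sub>R complex_of_real (cmod z ^ (2 * k) * exp (- \<alpha> * (cmod z)\<^sup>2))))"
      unfolding f_def zk by (rule ext) (simp only: \<rho>_def scaleR_conv_of_real of_real_mult mult_ac)
    then show ?thesis by (simp only: integral_mult_right_zero)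
  qed
  ultimately show ?thesis by simp
qed

text \<open>Limit of the formula on discs as the radius tends to infinity, by dominated convergence
  on both sides; the remaining integral is a Gaussian moment.\<close>

lemma integral_power_series_times_cnj_power:
  fixes g :: "complex \<Rightarrow> complex" and b :: "nat \<Rightarrow> complex"
  assumes \<alpha>: "0 < \<alpha>" and sums: "\<And>z. (\<lambda>j. b j * z ^ j) sums g z"
    and int: "integrable lborel (\<lambda>z. g z * cnj z ^ k * complex_of_real (exp (- \<alpha> * (cmod z)\<^sup>2)))"
  shows "(LINT z|lborel. g z * cnj z ^ k * complex_of_real (exp (- \<alpha> * (cmod z)\<^sup>2)))
    = b k * of_real (pi * fact k / \<alpha> ^ Suc k)"
proof -
  let ?h = "\<lambda>z::complex. complex_of_real (cmod z ^ (2 * k) * exp (- \<alpha> * (cmod z)\<^sup>2))"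
  have "integrable lborel ?h"
    using integrable_power_cmod_gauss[OF \<alpha>, of k] integrable_of_real by blast
  then have "(\<lambda>n. LINT z|lborel. indicator (cball 0 (real n)) z *\<^sub>R ?h z) \<longlonglongrightarrow> (LINT z|lborel. ?h z)"
    by (rule integral_cball_tendsto)
  then have "(\<lambda>n. b k * (LINT z|lborel. indicator (cball 0 (real n)) z *\<^sub>R ?h z)) \<longlonglongrightarrow> b k * (LINT z|lborel. ?h z)"
    by (intro tendsto_intros)
  moreover have "\<forall>\<^sub>F n in sequentially. b k * (LINT z|lborel. indicator (cball 0 (real n)) z *\<^sub>R ?h z)
      = (LINT z|lborel. indicator (cball 0 (real n)) z *\<^sub>R (g z * cnj z ^ k * complex_of_real (exp (- \<alpha> * (cmod z)\<^sup>2))))"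
    using eventually_gt_at_top[of 0]
    by eventually_elim (subst integral_cball_power_series_times_cnj_power[OF sums], auto)
  ultimately have "(\<lambda>n. LINT z|lborel. indicator (cball 0 (real n)) z *\<^sub>R (g z * cnj z ^ k * complex_of_real (exp (- \<alpha> * (cmod z)\<^sup>2))))
      \<longlonglongrightarrow> b k * (LINT z|lborel. ?h z)"
    by (rule Lim_transform_eventually)
  then have "(LINT z|lborel. g z * cnj z ^ k * complex_of_real (exp (- \<alpha> * (cmod z)\<^sup>2))) = b k * (LINT z|lborel. ?h z)"
    using integral_cball_tendsto[OF int] LIMSEQ_unique by blast
  also have "(LINT z|lborel. ?h z) = of_real (pi * fact k / \<alpha> ^ Suc k)"
    using integral_power_cmod_gauss[OF \<alpha>, of k] integral_complex_of_real by metis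
  finally show ?thesis .
qed

section \<open>Poisson tails\<close>

text \<open>The probability of the value \<open>k\<close> under the Poisson law of mean
  \<open>t\<close>. These weights are the squared coefficients of normalized kernels in translated
  bases.\<close>

definition poisson_weight :: "real \<Rightarrow> nat \<Rightarrow> real" where
  "poisson_weight t k = exp (- t) * t ^ k / fact k"

lemma poisson_weight_nonneg: "0 \<le> t \<Longrightarrow> 0 \<le> poisson_weight t k"
  by (simp add: poisson_weight_def)

lemma poisson_weight_sums: "poisson_weight t sums 1"
proof -
  have "(\<lambda>k. exp (- t) * (t ^ k /\<^sub>R fact k)) sums (exp (- t) * exp t)"
    by (intro sums_mult exp_converges)
  then show ?thesis
    by (simp add: poisson_weight_def[abs_def] exp_minus scaleR_conv_of_real field_simps)
qed

lemma sum_poisson_weight_le_1: "0 \<le> t \<Longrightarrow> finite A \<Longrightarrow> sum (poisson_weight t) A \<le> 1"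
  using sum_le_suminf[OF sums_summable[OF poisson_weight_sums], of A t]
    sums_unique[OF poisson_weight_sums, of t] poisson_weight_nonneg by simp

text \<open>Both tails are estimated by moving the mean \<open>t\<close> to a mean \<open>s\<close> lying between \<open>t\<close> and \<open>k\<close>.\<close>

lemma poisson_weight_shift:
  assumes s: "0 < s" and t: "0 \<le> t" and D: "D \<le> (t - s) * (s - real k) / s"
  shows "poisson_weight t k \<le> exp (- D) * poisson_weight s k"
proof -
  \<comment> \<open>The quotient of the two weights is \<open>exp (s - t) * (t / s) ^ k\<close>. The
    estimate of \<open>t / s\<close> by \<open>exp (t / s - 1)\<close> turns it into the exponential
    of \<open>- ((t - s) * (s - real k) / s)\<close>.\<close>
  have "(t / s) ^ k \<le> exp (t / s - 1) ^ k"
    using exp_ge_add_one_self[of "t / s - 1"] s t by (intro power_mono) auto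
  also have "\<dots> = exp (real k * (t / s - 1))" by (simp add: exp_of_nat_mult)
  finally have "t ^ k \<le> s ^ k * exp (real k * (t / s - 1))"
    using s by (simp add: power_divide field_simps)
  then have "exp (- t) * t ^ k \<le> exp (- t) * (s ^ k * exp (real k * (t / s - 1)))"
    by simp
  also have "\<dots> = exp (- t + real k * (t / s - 1)) * s ^ k"
    by (simp only: exp_add mult_ac)
  also have "- t + real k * (t / s - 1) = - ((t - s) * (s - real k) / s) - s"
    using s by (simp add: field_simps)
  also have "exp (- ((t - s) * (s - real k) / s) - s) \<le> exp (- D - s)"
    using D by simp
  also have "exp (- D - s) = exp (- D) * exp (- s)" by (simp add: exp_diff exp_minus field_simps)
  finally have "exp (- t) * t ^ k \<le> exp (- D) * (exp (- s) * s ^ k)"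
    using s by (simp add: mult_ac mult_right_mono)
  then show ?thesis by (simp add: poisson_weight_def divide_right_mono)
qed

text \<open>The intermediate mean belongs to the radius \<open>d + K / 2\<close>. Both
  \<open>s - t\<close> and \<open>k - s\<close> are then at least
  \<open>\<alpha> * (K / 2 * (d + K / 2))\<close>, whose square is
  \<open>\<alpha> * K\<^sup>2 / 4\<close> times \<open>s\<close>; the weights of mean
  \<open>s\<close> add up to at most 1.\<close>

lemma poisson_upper_tail:
  assumes \<alpha>: "0 < \<alpha>" and K: "0 < K" and d: "0 \<le> d" and m: "d + K \<le> sqrt (real m / \<alpha>)"
  shows "sum (poisson_weight (\<alpha> * d\<^sup>2)) {m..<N} \<le> exp (- (\<alpha> * K\<^sup>2 / 4))"
proof -
  let ?t = "\<alpha> * d\<^sup>2" and ?s = "\<alpha> * (d + K / 2)\<^sup>2"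
  have s: "0 < ?s" using \<alpha> K d by (intro mult_pos_pos zero_less_power) auto
  have "(d + K)\<^sup>2 \<le> (sqrt (real m / \<alpha>))\<^sup>2" using m d K by (intro power_mono) auto
  then have m': "\<alpha> * (d + K)\<^sup>2 \<le> real m" using \<alpha> by (simp add: field_simps)
  have "sum (poisson_weight ?t) {m..<N} \<le> (\<Sum>k\<in>{m..<N}. exp (- (\<alpha> * K\<^sup>2 / 4)) * poisson_weight ?s k)"
  proof (rule sum_mono)
    fix k assume "k \<in> {m..<N}"
    then have k: "\<alpha> * (d + K)\<^sup>2 \<le> real k" using m' by simp
    have "\<alpha> * K\<^sup>2 / 4 * ?s \<le> (?s - ?t) * (real k - ?s)"
    proof -
      have "\<alpha> * K\<^sup>2 / 4 * ?s = (\<alpha> * (K / 2 * (d + K / 2))) * (\<alpha> * (K / 2 * (d + K / 2)))"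
        by (simp add: power2_eq_square algebra_simps)
      also have "\<dots> \<le> (?s - ?t) * (\<alpha> * (d + K)\<^sup>2 - ?s)"
      proof (rule mult_mono)
        have "K / 2 * d + K / 2 * (K / 2) \<le> K * d + K / 2 * (K / 2)" using K d by simp
        then have "K / 2 * (d + K / 2) \<le> (d + K / 2)\<^sup>2 - d\<^sup>2"
          by (simp add: power2_eq_square algebra_simps)
        from mult_left_mono[OF this, of \<alpha>] show "\<alpha> * (K / 2 * (d + K / 2)) \<le> ?s - ?t"
          using \<alpha> by (simp add: right_diff_distrib)
        have "0 \<le> K * d" "0 \<le> K * K" using K d by simp_all
        then have "K * d / 2 + K * K / 4 \<le> K * d + K * K * 3 / 4" by linarith
        then have "K / 2 * (d + K / 2) \<le> (d + K)\<^sup>2 - (d + K / 2)\<^sup>2"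
          by (simp add: power2_eq_square algebra_simps)
        from mult_left_mono[OF this, of \<alpha>] show "\<alpha> * (K / 2 * (d + K / 2)) \<le> \<alpha> * (d + K)\<^sup>2 - ?s"
          using \<alpha> by (simp add: right_diff_distrib)
        show "0 \<le> ?s - ?t" using \<alpha> K d by (simp add: power2_eq_square algebra_simps)
      qed (use \<alpha> K d in auto)
      also have "\<dots> \<le> (?s - ?t) * (real k - ?s)"
        using k \<alpha> K d by (intro mult_left_mono) (auto simp: power2_eq_square algebra_simps)
      finally show ?thesis .
    qed
    then have "\<alpha> * K\<^sup>2 / 4 \<le> (?t - ?s) * (?s - real k) / ?s"
      using s by (simp add: pos_le_divide_eq) (simp add: algebra_simps)
    then show "poisson_weight ?t k \<le> exp (- (\<alpha> * K\<^sup>2 / 4)) * poisson_weight ?s k"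
      using s \<alpha> by (intro poisson_weight_shift) auto
  qed
  also have "\<dots> \<le> exp (- (\<alpha> * K\<^sup>2 / 4)) * 1"
    unfolding sum_distrib_left[symmetric]
    using s by (intro mult_left_mono sum_poisson_weight_le_1) auto
  finally show ?thesis by simp
qed

text \<open>The tail at \<open>d\<close> is compared with the tail at the smaller radius
  \<open>d'\<close> instead of being bounded by a constant: after summation over the divisor, the
  tails at \<open>d'\<close> are controlled by the upper sampling inequality. The exponent comes
  from gaps of at least \<open>\<alpha> * (K / 5 * d')\<close> and
  \<open>\<alpha> * (K / 2 * d')\<close> between the means and \<open>k\<close>.\<close>

lemma poisson_lower_tail:
  assumes \<alpha>: "0 < \<alpha>" and K: "0 < K" and d': "sqrt (real m / \<alpha>) + K / 2 \<le> d'" and d: "d' + K / 5 \<le> d"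
  shows "sum (poisson_weight (\<alpha> * d\<^sup>2)) {..<m} \<le> exp (- (\<alpha> * K\<^sup>2 / 10)) * sum (poisson_weight (\<alpha> * d'\<^sup>2)) {..<m}"
  unfolding sum_distrib_left
proof (rule sum_mono)
  fix k assume k: "k \<in> {..<m}"
  let ?t = "\<alpha> * d\<^sup>2" and ?s = "\<alpha> * d'\<^sup>2"
  have r0: "0 \<le> sqrt (real m / \<alpha>)" using \<alpha> by simp
  have d'0: "0 < d'" using d' K r0 by linarith
  have s: "0 < ?s" using \<alpha> d'0 by (intro mult_pos_pos zero_less_power) auto
  have "sqrt (real m / \<alpha>) \<le> d' - K / 2" using d' by simp
  then have "(sqrt (real m / \<alpha>))\<^sup>2 \<le> (d' - K / 2)\<^sup>2" using r0 by (intro power_mono) auto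
  then have "real m \<le> \<alpha> * (d' - K / 2)\<^sup>2" using \<alpha> by (simp add: field_simps)
  then have k': "real k \<le> \<alpha> * (d' - K / 2)\<^sup>2" using k by simp
  have "\<alpha> * K\<^sup>2 / 10 * ?s = (\<alpha> * (K / 5 * d')) * (\<alpha> * (K / 2 * d'))"
    by (simp add: power2_eq_square algebra_simps)
  also have "\<dots> \<le> (?t - ?s) * (?s - real k)"
  proof (rule mult_mono)
    have "K / 5 * d' \<le> (d' + K / 5)\<^sup>2 - d'\<^sup>2"
      using K d'0 by (simp add: power2_eq_square algebra_simps)
    also have "(d' + K / 5)\<^sup>2 \<le> d\<^sup>2" using d d'0 K by (intro power_mono) auto
    finally have "K / 5 * d' \<le> d\<^sup>2 - d'\<^sup>2" by simp
    from mult_left_mono[OF this, of \<alpha>] show 1: "\<alpha> * (K / 5 * d') \<le> ?t - ?s"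
      using \<alpha> by (simp add: right_diff_distrib)
    have "K / 2 \<le> d'" using d' r0 by linarith
    then have "K * K / 2 \<le> K * d'" using K by simp
    then have "K / 2 * d' \<le> d'\<^sup>2 - (d' - K / 2)\<^sup>2"
      by (simp add: power2_eq_square algebra_simps)
    from mult_left_mono[OF this, of \<alpha>] show "\<alpha> * (K / 2 * d') \<le> ?s - real k"
      using \<alpha> k' by (simp add: right_diff_distrib)
    have "0 \<le> \<alpha> * (K / 5 * d')" using \<alpha> K d'0 by simp
    then show "0 \<le> ?t - ?s" using 1 by linarith
  qed (use \<alpha> K d'0 in auto)
  finally have "\<alpha> * K\<^sup>2 / 10 \<le> (?t - ?s) * (?s - real k) / ?s"
    using s by (simp add: pos_le_divide_eq)
  then show "poisson_weight ?t k \<le> exp (- (\<alpha> * K\<^sup>2 / 10)) * poisson_weight ?s k"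
    using s \<alpha> by (intro poisson_weight_shift) auto
qed

text \<open>Replaces an average over a circle about \<open>p\<close>: four points suffice to come closer to every centre.\<close>

lemma quarter_turn_step_towards:
  fixes p l :: complex
  assumes K: "0 < K" and d: "K \<le> dist p l"
  shows "\<exists>j\<in>{..<4::nat}. dist (p + of_real (K / 2) * \<i> ^ j) l + K / 5 \<le> dist p l"
proof -
  define x where "x = Re (l - p)"
  define y where "y = Im (l - p)"
  have dd: "(dist p l)\<^sup>2 = x\<^sup>2 + y\<^sup>2"
    by (simp add: dist_norm norm_minus_commute[of p] cmod_power2 x_def y_def)
  have step: "dist q l + K / 5 \<le> dist p l"
    if q: "(dist q l)\<^sup>2 = (dist p l)\<^sup>2 - K * c + K\<^sup>2 / 4" and c: "(dist p l)\<^sup>2 \<le> 2 * c\<^sup>2" "0 \<le> c" for q c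
  proof -
    \<comment> \<open>Here \<open>c\<close> is the component of \<open>l - p\<close> along the step.
      The best of the four directions has \<open>c\<close> at least \<open>dist p l\<close> divided
      by \<open>sqrt 2\<close>, and 7/10 is a rational number just below that ratio.\<close>
    have "49 * (dist p l)\<^sup>2 \<le> 100 * c\<^sup>2" using c(1) zero_le_power2[of c] by linarith
    then have "(7 / 10 * dist p l)\<^sup>2 \<le> c\<^sup>2"
      by (simp add: power_mult_distrib power_divide)
    then have "7 / 10 * dist p l \<le> c" using c(2) by (rule power2_le_imp_le)
    then have "K * (7 / 10 * dist p l) \<le> K * c" by (rule mult_left_mono) (use K in simp)
    then have "7 / 10 * (K * dist p l) \<le> K * c" by (simp only: mult.left_commute)
    moreover have "K\<^sup>2 \<le> K * dist p l" using K d by (simp add: power2_eq_square)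
    moreover have "(dist p l - K / 5)\<^sup>2 = (dist p l)\<^sup>2 - 2 / 5 * (K * dist p l) + K\<^sup>2 / 25"
      by (simp add: power2_eq_square algebra_simps)
    moreover have "0 \<le> K\<^sup>2" by simp
    ultimately have "(dist q l)\<^sup>2 \<le> (dist p l - K / 5)\<^sup>2"
      unfolding q by linarith
    then have "dist q l \<le> dist p l - K / 5" by (rule power2_le_imp_le) (use K d in simp)
    then show ?thesis by simp
  qed
  have sq: "(dist (p + of_real (K / 2) * u) l)\<^sup>2 = (dist p l)\<^sup>2 - K * (x * Re u + y * Im u) + K\<^sup>2 / 4"
    if "cmod u = 1" for u
  proof -
    have u: "(Re u)\<^sup>2 + (Im u)\<^sup>2 = 1" using that cmod_power2[of u] by simp
    have "(dist (p + of_real (K / 2) * u) l)\<^sup>2 = (x - K / 2 * Re u)\<^sup>2 + (y - K / 2 * Im u)\<^sup>2"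
      unfolding dist_norm cmod_power2 by (simp add: x_def y_def power2_eq_square algebra_simps)
    also have "\<dots> = x\<^sup>2 + y\<^sup>2 - K * (x * Re u + y * Im u) + K\<^sup>2 / 4 * ((Re u)\<^sup>2 + (Im u)\<^sup>2)"
      by (simp add: power2_eq_square algebra_simps)
    finally show ?thesis unfolding u dd by simp
  qed
  have sqle: "a\<^sup>2 \<le> c\<^sup>2" if "\<bar>a\<bar> \<le> c" for a c :: real
    using power_mono[OF that, of 2] by simp
  have i: "\<i> ^ 3 = - \<i>" "\<i> ^ 2 = - 1" by (simp_all add: power3_eq_cube)
  \<comment> \<open>The four closed sectors around the coordinate half axes; the step is taken along
    the axis of the sector that contains \<open>l - p\<close>.\<close>
  consider "\<bar>y\<bar> \<le> x" | "\<bar>x\<bar> \<le> y" | "\<bar>y\<bar> \<le> - x" | "\<bar>x\<bar> \<le> - y" by linarith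
  then show ?thesis
  proof cases
    case 1
    then have "dist (p + of_real (K / 2) * \<i> ^ 0) l + K / 5 \<le> dist p l"
      by (intro step[OF sq]) (auto simp: dd dest: sqle)
    then show ?thesis by (intro bexI[of _ 0]) simp_all
  next
    case 2
    then have "dist (p + of_real (K / 2) * \<i> ^ 1) l + K / 5 \<le> dist p l"
      by (intro step[OF sq]) (auto simp: dd dest: sqle)
    then show ?thesis by (intro bexI[of _ 1]) simp_all
  next
    case 3
    then have "dist (p + of_real (K / 2) * \<i> ^ 2) l + K / 5 \<le> dist p l"
      by (intro step[OF sq]) (auto simp: dd dest: sqle)
    then show ?thesis by (intro bexI[of _ 2]) simp_all
  next
    case 4
    then have "dist (p + of_real (K / 2) * \<i> ^ 3) l + K / 5 \<le> dist p l"
      by (intro step[OF sq]) (auto simp: dd i dest: sqle)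
    then show ?thesis by (intro bexI[of _ 3]) simp_all
  qed
qed

section \<open>Fock space\<close>

lemma continuous_on_fock:
  "f \<in> fock_space \<alpha> \<Longrightarrow> continuous_on UNIV f"
  by (auto simp: fock_space_def intro: holomorphic_on_imp_continuous_on)

lemma integrable_fock_inner:
  assumes f: "f \<in> fock_space \<alpha>" and g: "g \<in> fock_space \<alpha>"
  shows "integrable lborel (\<lambda>z. f z * cnj (g z) * complex_of_real (exp (- \<alpha> * (cmod z)\<^sup>2)))"
proof (rule Bochner_Integration.integrable_bound)
  let ?w = "\<lambda>z::complex. exp (- \<alpha> * (cmod z)\<^sup>2)"
  show "integrable lborel (\<lambda>z. (cmod (f z))\<^sup>2 * ?w z + (cmod (g z))\<^sup>2 * ?w z)"
    using f g by (auto simp: fock_space_def)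
  have "(\<lambda>z. f z * cnj (g z) * complex_of_real (?w z)) \<in> borel_measurable borel"
    by (intro borel_measurable_continuous_onI continuous_intros continuous_on_fock[OF f] continuous_on_fock[OF g])
  then show "(\<lambda>z. f z * cnj (g z) * complex_of_real (?w z)) \<in> borel_measurable lborel"
    by simp
  have ab: "a * b \<le> a\<^sup>2 + b\<^sup>2" for a b :: real
    using sum_squares_bound[of a b] zero_le_power2[of a] zero_le_power2[of b] by linarith
  show "AE z in lborel. norm (f z * cnj (g z) * complex_of_real (?w z))
      \<le> norm ((cmod (f z))\<^sup>2 * ?w z + (cmod (g z))\<^sup>2 * ?w z)"
    by (intro AE_I2) (simp add: norm_mult mult_right_mono ab flip: distrib_right)
qed

lemma fock_space_add_mult:
  assumes f: "f \<in> fock_space \<alpha>" and g: "g \<in> fock_space \<alpha>"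
  shows "(\<lambda>z. f z + c * g z) \<in> fock_space \<alpha>"
proof -
  let ?w = "\<lambda>z::complex. exp (- \<alpha> * (cmod z)\<^sup>2)"
  have "integrable lborel (\<lambda>z. (cmod (f z + c * g z))\<^sup>2 * ?w z)"
  proof (rule Bochner_Integration.integrable_bound)
    show "integrable lborel (\<lambda>z. 2 * ((cmod (f z))\<^sup>2 * ?w z) + 2 * (cmod c)\<^sup>2 * ((cmod (g z))\<^sup>2 * ?w z))"
      using f g by (auto simp: fock_space_def)
    have "(\<lambda>z. (cmod (f z + c * g z))\<^sup>2 * ?w z) \<in> borel_measurable borel"
      by (intro borel_measurable_continuous_onI continuous_intros continuous_on_fock[OF f] continuous_on_fock[OF g])
    then show "(\<lambda>z. (cmod (f z + c * g z))\<^sup>2 * ?w z) \<in> borel_measurable lborel"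
      by simp
    have "(cmod (x + y))\<^sup>2 \<le> 2 * (cmod x)\<^sup>2 + 2 * (cmod y)\<^sup>2" for x y
    proof -
      have "(cmod (x + y))\<^sup>2 \<le> (cmod x + cmod y)\<^sup>2" by (intro power_mono norm_triangle_ineq) simp
      also have "\<dots> \<le> 2 * (cmod x)\<^sup>2 + 2 * (cmod y)\<^sup>2"
        using sum_squares_bound[of "cmod x" "cmod y"] by (simp add: power2_sum)
      finally show ?thesis .
    qed
    from this[of "f z" "c * g z" for z]
    have "(cmod (f z + c * g z))\<^sup>2 * ?w z \<le> (2 * (cmod (f z))\<^sup>2 + 2 * (cmod (c * g z))\<^sup>2) * ?w z" for z
      by (rule mult_right_mono) simp
    then show "AE z in lborel. norm ((cmod (f z + c * g z))\<^sup>2 * ?w z)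
        \<le> norm (2 * ((cmod (f z))\<^sup>2 * ?w z) + 2 * (cmod c)\<^sup>2 * ((cmod (g z))\<^sup>2 * ?w z))"
      by (intro AE_I2) (simp add: norm_mult power_mult_distrib algebra_simps)
  qed
  moreover have "(\<lambda>z. f z + c * g z) holomorphic_on UNIV"
    using f g by (auto simp: fock_space_def intro!: holomorphic_intros)
  ultimately show ?thesis by (simp add: fock_space_def)
qed

lemma fock_space_diff:
  "f \<in> fock_space \<alpha> \<Longrightarrow> g \<in> fock_space \<alpha> \<Longrightarrow> (\<lambda>z. f z - g z) \<in> fock_space \<alpha>"
  using fock_space_add_mult[of f \<alpha> g "- 1"] by simp

lemma fock_inner_diff_left:
  assumes "f \<in> fock_space \<alpha>" "g \<in> fock_space \<alpha>" "h \<in> fock_space \<alpha>"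
  shows "fock_inner \<alpha> (\<lambda>z. f z - g z) h = fock_inner \<alpha> f h - fock_inner \<alpha> g h"
proof -
  have "(\<lambda>z. (f z - g z) * cnj (h z) * complex_of_real (exp (- \<alpha> * (cmod z)\<^sup>2)))
    = (\<lambda>z. f z * cnj (h z) * complex_of_real (exp (- \<alpha> * (cmod z)\<^sup>2))
        - g z * cnj (h z) * complex_of_real (exp (- \<alpha> * (cmod z)\<^sup>2)))"
    by (simp add: fun_eq_iff algebra_simps)
  then show ?thesis
    unfolding fock_inner_def
    by (simp only: Bochner_Integration.integral_diff[OF integrable_fock_inner[OF assms(1,3)]
          integrable_fock_inner[OF assms(2,3)]] right_diff_distrib)
qed

lemma fock_inner_add_mult_right:
  assumes "f \<in> fock_space \<alpha>" "g \<in> fock_space \<alpha>" "h \<in> fock_space \<alpha>"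
  shows "fock_inner \<alpha> f (\<lambda>z. g z + c * h z) = fock_inner \<alpha> f g + cnj c * fock_inner \<alpha> f h"
proof -
  have "(\<lambda>z. f z * cnj (g z + c * h z) * complex_of_real (exp (- \<alpha> * (cmod z)\<^sup>2)))
    = (\<lambda>z. f z * cnj (g z) * complex_of_real (exp (- \<alpha> * (cmod z)\<^sup>2))
        + cnj c * (f z * cnj (h z) * complex_of_real (exp (- \<alpha> * (cmod z)\<^sup>2))))"
    by (simp add: fun_eq_iff algebra_simps)
  then have "(LINT z|lborel. f z * cnj (g z + c * h z) * complex_of_real (exp (- \<alpha> * (cmod z)\<^sup>2)))
    = (LINT z|lborel. f z * cnj (g z) * complex_of_real (exp (- \<alpha> * (cmod z)\<^sup>2)))
      + cnj c * (LINT z|lborel. f z * cnj (h z) * complex_of_real (exp (- \<alpha> * (cmod z)\<^sup>2)))"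
    by (simp only: Bochner_Integration.integral_add[OF integrable_fock_inner[OF assms(1,2)]
          integrable_mult_right[OF integrable_fock_inner[OF assms(1,3)]]] integral_mult_right_zero)
  then show ?thesis unfolding fock_inner_def by (simp add: algebra_simps)
qed

lemma fock_norm_sq_eq_inner:
  assumes "f \<in> fock_space \<alpha>"
  shows "fock_inner \<alpha> f f = of_real (fock_norm_sq \<alpha> f)"
proof -
  have eq: "(\<lambda>z. f z * cnj (f z) * complex_of_real (exp (- \<alpha> * (cmod z)\<^sup>2)))
      = (\<lambda>z. complex_of_real ((cmod (f z))\<^sup>2 * exp (- \<alpha> * (cmod z)\<^sup>2)))"
    by (simp add: fun_eq_iff flip: complex_norm_square)
  show ?thesis
    unfolding fock_inner_def fock_norm_sq_def eq integral_complex_of_real by simp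
qed

lemma fock_norm_sq_nonneg: "0 < \<alpha> \<Longrightarrow> 0 \<le> fock_norm_sq \<alpha> f"
  unfolding fock_norm_sq_def by (intro mult_nonneg_nonneg integral_nonneg_AE) auto

lemma fock_norm_sq_add:
  assumes f: "f \<in> fock_space \<alpha>" and g: "g \<in> fock_space \<alpha>"
  shows "fock_norm_sq \<alpha> (\<lambda>z. f z + g z) = fock_norm_sq \<alpha> f + 2 * Re (fock_inner \<alpha> f g) + fock_norm_sq \<alpha> g"
proof -
  let ?w = "\<lambda>z::complex. exp (- \<alpha> * (cmod z)\<^sup>2)"
  have pt: "(\<lambda>z. (cmod (f z + g z))\<^sup>2 * ?w z) = (\<lambda>z. (cmod (f z))\<^sup>2 * ?w z
     + 2 * Re (f z * cnj (g z) * complex_of_real (?w z)) + (cmod (g z))\<^sup>2 * ?w z)"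
    unfolding cmod_power2 by (simp add: fun_eq_iff power2_eq_square algebra_simps)
  have i: "integrable lborel (\<lambda>z. (cmod (f z))\<^sup>2 * ?w z)" "integrable lborel (\<lambda>z. (cmod (g z))\<^sup>2 * ?w z)"
    using f g by (auto simp: fock_space_def)
  have ii: "integrable lborel (\<lambda>z. 2 * Re (f z * cnj (g z) * complex_of_real (?w z)))"
    by (intro integrable_mult_right integrable_Re integrable_fock_inner f g)
  have "(LINT z|lborel. (cmod (f z + g z))\<^sup>2 * ?w z) = (LINT z|lborel. (cmod (f z))\<^sup>2 * ?w z)
     + 2 * Re (LINT z|lborel. f z * cnj (g z) * complex_of_real (?w z)) + (LINT z|lborel. (cmod (g z))\<^sup>2 * ?w z)"
    unfolding pt
    by (simp only: Bochner_Integration.integral_add[OF Bochner_Integration.integrable_add[OF i(1) ii] i(2)]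
      Bochner_Integration.integral_add[OF i(1) ii] integral_mult_right_zero integral_Re[OF integrable_fock_inner[OF f g]])
  then show ?thesis unfolding fock_norm_sq_def fock_inner_def by (simp add: algebra_simps)
qed

text \<open>The parallelogram law with the nonnegative term for \<open>f + g\<close>
  dropped.\<close>

lemma fock_norm_sq_diff_le:
  assumes \<alpha>: "0 < \<alpha>" and f: "f \<in> fock_space \<alpha>" and g: "g \<in> fock_space \<alpha>"
  shows "fock_norm_sq \<alpha> (\<lambda>z. f z - g z) \<le> 2 * fock_norm_sq \<alpha> f + 2 * fock_norm_sq \<alpha> g"
proof -
  have "fock_norm_sq \<alpha> f = fock_norm_sq \<alpha> (\<lambda>z. (f z - g z) + g z)" by simp
  have mg: "(\<lambda>z. 0 - g z) \<in> fock_space \<alpha>"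
    by (rule fock_space_diff[OF _ g]) (simp add: fock_space_def)
  have neg: "fock_norm_sq \<alpha> (\<lambda>z. 0 - g z) = fock_norm_sq \<alpha> g" by (simp add: fock_norm_sq_def)
  have "fock_inner \<alpha> f (\<lambda>z. 0 - g z) = - fock_inner \<alpha> f g"
    unfolding fock_inner_def by simp
  then have "fock_norm_sq \<alpha> (\<lambda>z. f z - g z) = fock_norm_sq \<alpha> f - 2 * Re (fock_inner \<alpha> f g) + fock_norm_sq \<alpha> g"
    using fock_norm_sq_add[OF f mg] neg by simp
  then show ?thesis
    using fock_norm_sq_add[OF f g] fock_norm_sq_nonneg[OF \<alpha>, of "\<lambda>z. f z + g z"] by linarith
qed

section \<open>The monomial basis, expansions and Bessel's inequality\<close>

lemma cmod_fock_basis_sq: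
  "0 < \<alpha> \<Longrightarrow> (cmod (fock_basis \<alpha> k z))\<^sup>2 = \<alpha> ^ k / fact k * cmod z ^ (2 * k)"
  by (simp add: fock_basis_def norm_mult norm_power power_mult_distrib power_even_eq)

lemma fock_basis_in_fock_space:
  assumes "0 < \<alpha>"
  shows "fock_basis \<alpha> k \<in> fock_space \<alpha>"
proof -
  have "(\<lambda>z. (cmod (fock_basis \<alpha> k z))\<^sup>2 * exp (- \<alpha> * (cmod z)\<^sup>2))
     = (\<lambda>z. (\<alpha> ^ k / fact k) * (cmod z ^ (2 * k) * exp (- \<alpha> * (cmod z)\<^sup>2)))"
    using assms by (simp add: fun_eq_iff cmod_fock_basis_sq)
  moreover have "fock_basis \<alpha> k holomorphic_on UNIV"
    unfolding fock_basis_def[abs_def] by (intro holomorphic_intros)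
  ultimately show ?thesis
    using integrable_power_cmod_gauss[OF assms, of k] by (simp add: fock_space_def)
qed

text \<open>Integration against the k-th monomial isolates the k-th Taylor coefficient. Any function
  with an explicit power series thus has explicit basis coefficients.\<close>

lemma fock_inner_basis:
  assumes \<alpha>: "0 < \<alpha>" and g: "g \<in> fock_space \<alpha>" and sums: "\<And>z. (\<lambda>j. b j * z ^ j) sums g z"
  shows "fock_inner \<alpha> g (fock_basis \<alpha> k) = b k * of_real (sqrt (fact k / \<alpha> ^ k))"
proof -
  let ?c = "sqrt (\<alpha> ^ k / fact k)"
  have c0: "?c \<noteq> 0" using \<alpha> by simp
  have eq: "(\<lambda>z. g z * cnj (fock_basis \<alpha> k z) * complex_of_real (exp (- \<alpha> * (cmod z)\<^sup>2)))
     = (\<lambda>z. of_real ?c * (g z * cnj z ^ k * complex_of_real (exp (- \<alpha> * (cmod z)\<^sup>2))))"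
    by (simp add: fun_eq_iff fock_basis_def mult_ac)
  have int: "integrable lborel (\<lambda>z. g z * cnj z ^ k * complex_of_real (exp (- \<alpha> * (cmod z)\<^sup>2)))"
  proof -
    have "integrable lborel (\<lambda>z. inverse (of_real ?c) * (of_real ?c * (g z * cnj z ^ k * complex_of_real (exp (- \<alpha> * (cmod z)\<^sup>2)))))"
      by (rule integrable_mult_right) (rule integrable_fock_inner[OF g fock_basis_in_fock_space[OF \<alpha>, of k], unfolded eq])
    moreover have "inverse (of_real ?c) * (of_real ?c * x) = x" for x :: complex
      using c0 by (simp only: mult.assoc[symmetric] of_real_eq_0_iff left_inverse mult_1 not_False_eq_True)
    ultimately show ?thesis by (simp only:)
  qed
  have "fock_inner \<alpha> g (fock_basis \<alpha> k)
      = complex_of_real (\<alpha> / pi) * (of_real ?c * (b k * of_real (pi * fact k / \<alpha> ^ Suc k)))"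
    unfolding fock_inner_def eq integral_mult_right_zero
      integral_power_series_times_cnj_power[OF \<alpha> sums int] ..
  also have "\<dots> = b k * of_real (\<alpha> / pi * ?c * (pi * fact k / \<alpha> ^ Suc k))"
    by (simp add: mult_ac)
  also have "\<alpha> / pi * ?c * (pi * fact k / \<alpha> ^ Suc k) = ?c * (fact k / \<alpha> ^ k)"
    using \<alpha> by (simp add: field_simps)
  also have "\<dots> = ?c * (sqrt (fact k / \<alpha> ^ k))\<^sup>2"
    using \<alpha> by (subst real_sqrt_pow2) auto
  also have "\<dots> = (?c * sqrt (fact k / \<alpha> ^ k)) * sqrt (fact k / \<alpha> ^ k)"
    by (simp only: power2_eq_square mult.assoc)
  also have "?c * sqrt (fact k / \<alpha> ^ k) = 1"
    using \<alpha> by (simp flip: real_sqrt_mult)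
  finally show ?thesis by simp
qed

text \<open>This is the Taylor series at 0: the normalizing factors in the coefficient and in the
  basis function are reciprocal. Convergence is pointwise, which is what point evaluations
  require.\<close>

lemma fock_expansion:
  assumes \<alpha>: "0 < \<alpha>" and g: "g \<in> fock_space \<alpha>"
  shows "(\<lambda>k. fock_inner \<alpha> g (fock_basis \<alpha> k) * fock_basis \<alpha> k z) sums g z"
proof -
  define b where "b = (\<lambda>k. (deriv ^^ k) g 0 / fact k)"
  have hol: "g holomorphic_on UNIV" using g by (simp add: fock_space_def)
  have sums: "(\<lambda>j. b j * z ^ j) sums g z" for z
  proof -
    have "(\<lambda>n. (deriv ^^ n) g 0 / fact n * (z - 0) ^ n) sums g z"
      by (rule holomorphic_power_series[where r="cmod z + 1"]) (use hol holomorphic_on_subset in auto)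
    then show ?thesis by (simp add: b_def)
  qed
  have "fock_inner \<alpha> g (fock_basis \<alpha> k) * fock_basis \<alpha> k z = b k * z ^ k" for k
  proof -
    have "sqrt (fact k / \<alpha> ^ k) * sqrt (\<alpha> ^ k / fact k) = 1"
      using \<alpha> by (simp flip: real_sqrt_mult)
    then have "complex_of_real (sqrt (fact k / \<alpha> ^ k)) * complex_of_real (sqrt (\<alpha> ^ k / fact k)) = 1"
      by (metis of_real_1 of_real_mult)
    then show ?thesis
      unfolding fock_inner_basis[OF \<alpha> g sums] fock_basis_def
      by (metis (no_types, lifting) mult.assoc mult.right_neutral)
  qed
  then show ?thesis using sums by simp
qed

lemma fock_partial_sum_in_fock_space:
  assumes \<alpha>: "0 < \<alpha>"
  shows "(\<lambda>z. \<Sum>k<n. a k * fock_basis \<alpha> k z) \<in> fock_space \<alpha>"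
proof (induction n)
  case 0
  then show ?case by (simp add: fock_space_def)
next
  case (Suc n)
  then show ?case
    using fock_space_add_mult[OF Suc fock_basis_in_fock_space[OF \<alpha>]] by simp
qed

lemma fock_inner_partial_sum:
  assumes \<alpha>: "0 < \<alpha>" and g: "g \<in> fock_space \<alpha>"
  shows "fock_inner \<alpha> g (\<lambda>z. \<Sum>k<n. a k * fock_basis \<alpha> k z)
    = (\<Sum>k<n. cnj (a k) * fock_inner \<alpha> g (fock_basis \<alpha> k))"
proof (induction n)
  case 0
  then show ?case by (simp add: fock_inner_def)
next
  case (Suc n)
  then show ?case
    using fock_inner_add_mult_right[OF g fock_partial_sum_in_fock_space[OF \<alpha>] fock_basis_in_fock_space[OF \<alpha>]]
    by simp
qed

text \<open>Orthonormality of the basis, obtained by reading the polynomial as a power series whose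
  coefficients are 0 from index \<open>n\<close> on.\<close>

lemma fock_inner_basis_partial_sum:
  assumes \<alpha>: "0 < \<alpha>" and k: "k < n"
  shows "fock_inner \<alpha> (\<lambda>z. \<Sum>k<n. a k * fock_basis \<alpha> k z) (fock_basis \<alpha> k) = a k"
proof -
  let ?b = "\<lambda>j. if j < n then a j * of_real (sqrt (\<alpha> ^ j / fact j)) else 0"
  have "(\<lambda>j. ?b j * z ^ j) sums (\<Sum>k<n. a k * fock_basis \<alpha> k z)" for z
  proof -
    have "(\<lambda>j. ?b j * z ^ j) sums (\<Sum>j<n. ?b j * z ^ j)"
      by (rule sums_finite) auto
    then show ?thesis by (simp add: fock_basis_def mult.assoc)
  qed
  then have "fock_inner \<alpha> (\<lambda>z. \<Sum>k<n. a k * fock_basis \<alpha> k z) (fock_basis \<alpha> k)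
      = ?b k * of_real (sqrt (fact k / \<alpha> ^ k))"
    by (rule fock_inner_basis[OF \<alpha> fock_partial_sum_in_fock_space[OF \<alpha>]])
  also have "\<dots> = a k * of_real (sqrt (\<alpha> ^ k / fact k) * sqrt (fact k / \<alpha> ^ k))" using k by simp
  also have "sqrt (\<alpha> ^ k / fact k) * sqrt (fact k / \<alpha> ^ k) = 1"
    using \<alpha> by (simp flip: real_sqrt_mult)
  finally show ?thesis by simp
qed

text \<open>Pythagoras for \<open>g = h + S\<close>, where \<open>S\<close> is the projection onto
  the first \<open>n\<close> basis functions and \<open>h\<close> is orthogonal to it.\<close>

lemma fock_bessel:
  assumes \<alpha>: "0 < \<alpha>" and g: "g \<in> fock_space \<alpha>"
  shows "(\<Sum>k<n. (cmod (fock_inner \<alpha> g (fock_basis \<alpha> k)))\<^sup>2) \<le> fock_norm_sq \<alpha> g"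
proof -
  define a where "a = (\<lambda>k. fock_inner \<alpha> g (fock_basis \<alpha> k))"
  define S where "S = (\<lambda>z. \<Sum>k<n. a k * fock_basis \<alpha> k z)"
  define h where "h = (\<lambda>z. g z - S z)"
  have S: "S \<in> fock_space \<alpha>" unfolding S_def by (rule fock_partial_sum_in_fock_space[OF \<alpha>])
  have h: "h \<in> fock_space \<alpha>" unfolding h_def by (rule fock_space_diff[OF g S])
  have Sk: "fock_inner \<alpha> S (fock_basis \<alpha> k) = a k" if "k < n" for k
    unfolding S_def using fock_inner_basis_partial_sum[OF \<alpha> that] .
  have "fock_inner \<alpha> h (fock_basis \<alpha> k) = 0" if "k < n" for k
    unfolding h_def using fock_inner_diff_left[OF g S fock_basis_in_fock_space[OF \<alpha>]] Sk[OF that]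
    by (simp add: a_def)
  then have hS: "fock_inner \<alpha> h S = 0"
    unfolding S_def fock_inner_partial_sum[OF \<alpha> h] by simp
  have "fock_inner \<alpha> S S = (\<Sum>k<n. cnj (a k) * fock_inner \<alpha> S (fock_basis \<alpha> k))"
    using fock_inner_partial_sum[OF \<alpha> S, where n=n and a=a] by (simp add: S_def)
  also have "\<dots> = (\<Sum>k<n. of_real ((cmod (a k))\<^sup>2))"
    by (rule sum.cong) (simp_all add: Sk complex_norm_square mult.commute del: of_real_power)
  also have "\<dots> = of_real (\<Sum>k<n. (cmod (a k))\<^sup>2)" by simp
  finally have "fock_norm_sq \<alpha> S = (\<Sum>k<n. (cmod (a k))\<^sup>2)"
    unfolding fock_norm_sq_eq_inner[OF S] using of_real_eq_iff by blast
  moreover have "fock_norm_sq \<alpha> g = fock_norm_sq \<alpha> h + fock_norm_sq \<alpha> S"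
    using fock_norm_sq_add[OF h S] hS by (simp add: h_def)
  ultimately show ?thesis using fock_norm_sq_nonneg[OF \<alpha>, of h] by (simp add: a_def)
qed

text \<open>The expansion of \<open>g\<close> starts at index \<open>m\<close>. Cauchy-Schwarz
  separates its coefficients, bounded by Bessel, from the weighted squares of the basis functions at
  \<open>z\<close>, which are Poisson weights.\<close>

lemma fock_point_estimate_of_orthogonal:
  assumes \<alpha>: "0 < \<alpha>" and g: "g \<in> fock_space \<alpha>"
    and orth: "\<And>k. k < m \<Longrightarrow> fock_inner \<alpha> g (fock_basis \<alpha> k) = 0"
    and tail: "\<And>N. sum (poisson_weight (\<alpha> * (cmod z)\<^sup>2)) {m..<N} \<le> \<delta>"
  shows "(cmod (g z))\<^sup>2 * exp (- \<alpha> * (cmod z)\<^sup>2) \<le> fock_norm_sq \<alpha> g * \<delta>"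
proof -
  define a where "a = (\<lambda>k. fock_inner \<alpha> g (fock_basis \<alpha> k))"
  let ?w = "exp (- \<alpha> * (cmod z)\<^sup>2)"
  have bound: "(cmod (\<Sum>k<N. a k * fock_basis \<alpha> k z))\<^sup>2 * ?w \<le> fock_norm_sq \<alpha> g * \<delta>" for N
  proof -
    have "(\<Sum>k<N. a k * fock_basis \<alpha> k z) = (\<Sum>k\<in>{m..<N}. a k * fock_basis \<alpha> k z)"
      by (rule sum.mono_neutral_right) (auto simp: a_def orth)
    then have "cmod (\<Sum>k<N. a k * fock_basis \<alpha> k z) \<le> (\<Sum>k\<in>{m..<N}. cmod (a k) * cmod (fock_basis \<alpha> k z))"
      by (simp add: sum_norm_le norm_mult)
    then have "(cmod (\<Sum>k<N. a k * fock_basis \<alpha> k z))\<^sup>2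
        \<le> (\<Sum>k\<in>{m..<N}. cmod (a k) * cmod (fock_basis \<alpha> k z))\<^sup>2"
      by (intro power_mono) auto
    also have "\<dots> \<le> (\<Sum>k\<in>{m..<N}. (cmod (a k))\<^sup>2) * (\<Sum>k\<in>{m..<N}. (cmod (fock_basis \<alpha> k z))\<^sup>2)"
      by (rule Cauchy_Schwarz_ineq_sum)
    finally have "(cmod (\<Sum>k<N. a k * fock_basis \<alpha> k z))\<^sup>2 * ?w
        \<le> (\<Sum>k\<in>{m..<N}. (cmod (a k))\<^sup>2) * ((\<Sum>k\<in>{m..<N}. (cmod (fock_basis \<alpha> k z))\<^sup>2) * ?w)"
      by (simp add: mult.assoc[symmetric] mult_right_mono)
    also have "(\<Sum>k\<in>{m..<N}. (cmod (fock_basis \<alpha> k z))\<^sup>2) * ?w = sum (poisson_weight (\<alpha> * (cmod z)\<^sup>2)) {m..<N}"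
      unfolding sum_distrib_right
      using \<alpha> by (intro sum.cong)
        (simp_all add: cmod_fock_basis_sq poisson_weight_def power_mult_distrib power_mult)
    also have "(\<Sum>k\<in>{m..<N}. (cmod (a k))\<^sup>2) * \<dots> \<le> fock_norm_sq \<alpha> g * \<delta>"
    proof (rule mult_mono)
      have "(\<Sum>k\<in>{m..<N}. (cmod (a k))\<^sup>2) \<le> (\<Sum>k<N. (cmod (a k))\<^sup>2)"
        by (rule sum_mono2) auto
      then show "(\<Sum>k\<in>{m..<N}. (cmod (a k))\<^sup>2) \<le> fock_norm_sq \<alpha> g"
        using fock_bessel[OF \<alpha> g, of N] by (simp add: a_def)
      show "0 \<le> sum (poisson_weight (\<alpha> * (cmod z)\<^sup>2)) {m..<N}"
        using \<alpha> by (intro sum_nonneg poisson_weight_nonneg) auto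
    qed (use tail fock_norm_sq_nonneg[OF \<alpha>] in auto)
    finally show ?thesis .
  qed
  have "(\<lambda>N. \<Sum>k<N. a k * fock_basis \<alpha> k z) \<longlonglongrightarrow> g z"
    using fock_expansion[OF \<alpha> g, of z] by (simp add: a_def sums_def)
  then have "(\<lambda>N. (cmod (\<Sum>k<N. a k * fock_basis \<alpha> k z))\<^sup>2 * ?w) \<longlonglongrightarrow> (cmod (g z))\<^sup>2 * ?w"
    by (intro tendsto_intros)
  then show ?thesis by (rule LIMSEQ_le_const2) (use bound in auto)
qed

section \<open>Translations\<close>

lemma integral_complex_shift:
  fixes h :: "complex \<Rightarrow> 'b :: {banach, second_countable_topology}"
  assumes [measurable]: "h \<in> borel_measurable borel"
  shows "(LINT z|lborel. h (z - l)) = (LINT z|lborel. h z)"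
    and "integrable lborel (\<lambda>z. h (z - l)) \<longleftrightarrow> integrable lborel h"
proof -
  have d: "distr lborel borel (\<lambda>z::complex. z - l) = lborel"
  proof -
    have "(\<lambda>z::complex. z - l) = (+) (- l)" by (simp add: fun_eq_iff)
    then show ?thesis by (simp only: lborel_distr_plus)
  qed
  have "(LINT z|lborel. h z) = (LINT z|distr lborel borel (\<lambda>z. z - l). h z)" by (simp add: d)
  also have "\<dots> = (LINT z|lborel. h (z - l))" by (subst integral_distr) simp_all
  finally show "(LINT z|lborel. h (z - l)) = (LINT z|lborel. h z)" ..
  have "integrable lborel h \<longleftrightarrow> integrable (distr lborel borel (\<lambda>z. z - l)) h" by (simp add: d)
  also have "\<dots> \<longleftrightarrow> integrable lborel (\<lambda>z. h (z - l))" by (subst integrable_distr_eq) simp_all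
  finally show "integrable lborel (\<lambda>z. h (z - l)) \<longleftrightarrow> integrable lborel h" ..
qed

text \<open>The exponential factor of the translation completes the square in the Gaussian. Isometry
  and the translation of pointwise estimates both rest on this identity.\<close>

lemma fock_translation_weighted:
  "(cmod (fock_translation \<alpha> l f z))\<^sup>2 * exp (- \<alpha> * (cmod z)\<^sup>2)
    = (cmod (f (z - l)))\<^sup>2 * exp (- \<alpha> * (cmod (z - l))\<^sup>2)"
proof -
  let ?E = "exp (\<alpha> * (Re l * Re z + Im l * Im z) - \<alpha> / 2 * (cmod l)\<^sup>2)"
  have "?E\<^sup>2 * exp (- \<alpha> * (cmod z)\<^sup>2)
      = exp (2 * (\<alpha> * (Re l * Re z + Im l * Im z) - \<alpha> / 2 * (cmod l)\<^sup>2) + - \<alpha> * (cmod z)\<^sup>2)"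
    by (simp only: exp_add exp_double)
  also have "2 * (\<alpha> * (Re l * Re z + Im l * Im z) - \<alpha> / 2 * (cmod l)\<^sup>2) + - \<alpha> * (cmod z)\<^sup>2
      = - \<alpha> * (cmod (z - l))\<^sup>2"
    unfolding cmod_power2 by (simp add: power2_eq_square algebra_simps)
  finally have E: "?E\<^sup>2 * exp (- \<alpha> * (cmod z)\<^sup>2) = exp (- \<alpha> * (cmod (z - l))\<^sup>2)" .
  have "cmod (fock_translation \<alpha> l f z) = ?E * cmod (f (z - l))"
    by (simp add: fock_translation_def norm_mult algebra_simps)
  then have "(cmod (fock_translation \<alpha> l f z))\<^sup>2 * exp (- \<alpha> * (cmod z)\<^sup>2)
      = (cmod (f (z - l)))\<^sup>2 * (?E\<^sup>2 * exp (- \<alpha> * (cmod z)\<^sup>2))"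
    by (simp only: power_mult_distrib mult_ac)
  then show ?thesis unfolding E .
qed

lemma
  assumes f: "f \<in> fock_space \<alpha>"
  shows fock_translation_in_fock_space: "fock_translation \<alpha> l f \<in> fock_space \<alpha>"
    and fock_norm_sq_translation: "fock_norm_sq \<alpha> (fock_translation \<alpha> l f) = fock_norm_sq \<alpha> f"
proof -
  let ?h = "\<lambda>z. (cmod (f z))\<^sup>2 * exp (- \<alpha> * (cmod z)\<^sup>2)"
  have m: "?h \<in> borel_measurable borel"
    by (intro borel_measurable_continuous_onI continuous_intros continuous_on_fock[OF f])
  have hol: "f holomorphic_on UNIV" using f by (simp add: fock_space_def)
  have "(f \<circ> (\<lambda>z. z - l)) holomorphic_on UNIV"
    by (rule holomorphic_on_compose) (auto intro!: holomorphic_intros holomorphic_on_subset[OF hol])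
  then have "fock_translation \<alpha> l f holomorphic_on UNIV"
    unfolding fock_translation_def[abs_def] by (intro holomorphic_intros) (simp add: o_def)
  moreover have "integrable lborel (\<lambda>z. ?h (z - l))"
    using f integral_complex_shift(2)[OF m] by (simp add: fock_space_def)
  ultimately show "fock_translation \<alpha> l f \<in> fock_space \<alpha>"
    by (simp add: fock_space_def fock_translation_weighted[simplified])
  show "fock_norm_sq \<alpha> (fock_translation \<alpha> l f) = fock_norm_sq \<alpha> f"
    unfolding fock_norm_sq_def fock_translation_weighted integral_complex_shift(1)[OF m] ..
qed

text \<open>The adjoint of a translation is the opposite translation, by the substitution of
  \<open>z - l\<close> for \<open>z\<close>. Coefficients against a basis translated to
  \<open>l\<close> thereby become Taylor coefficients at 0.\<close>

lemma fock_inner_translation_right: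
  assumes f: "f \<in> fock_space \<alpha>" and h: "h \<in> fock_space \<alpha>"
  shows "fock_inner \<alpha> f (fock_translation \<alpha> l h) = fock_inner \<alpha> (fock_translation \<alpha> (- l) f) h"
proof -
  define F where "F = (\<lambda>z. fock_translation \<alpha> (- l) f z * cnj (h z) * complex_of_real (exp (- \<alpha> * (cmod z)\<^sup>2)))"
  have "f z * cnj (fock_translation \<alpha> l h z) * complex_of_real (exp (- \<alpha> * (cmod z)\<^sup>2)) = F (z - l)" for z
  proof -
    let ?A = "of_real \<alpha> * l * cnj z - of_real (\<alpha> / 2 * (cmod l)\<^sup>2) + of_real (- \<alpha> * (cmod z)\<^sup>2)"
    let ?B = "of_real \<alpha> * cnj (- l) * (z - l) - of_real (\<alpha> / 2 * (cmod (- l))\<^sup>2)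
        + of_real (- \<alpha> * (cmod (z - l))\<^sup>2)"
    have "f z * cnj (fock_translation \<alpha> l h z) * complex_of_real (exp (- \<alpha> * (cmod z)\<^sup>2))
        = exp ?A * (f z * cnj (h (z - l)))"
      by (simp only: fock_translation_def exp_cnj exp_add exp_of_real complex_cnj_mult complex_cnj_diff
          complex_cnj_cnj complex_cnj_complex_of_real mult_ac)
    also have "?A = ?B"
      unfolding of_real_mult complex_norm_square by (simp add: algebra_simps)
    also have "exp ?B * (f z * cnj (h (z - l))) = F (z - l)"
      by (simp only: F_def fock_translation_def exp_add exp_of_real diff_minus_eq_add diff_add_cancel mult_ac)
    finally show ?thesis .
  qed
  moreover have "F \<in> borel_measurable borel"
    unfolding F_def
    by (intro borel_measurable_continuous_onI continuous_intros continuous_on_fock[OF h]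
        continuous_on_fock[OF fock_translation_in_fock_space[OF f]])
  ultimately show ?thesis
    unfolding fock_inner_def using integral_complex_shift(1)[of F l] by (simp add: F_def)
qed

section \<open>Normalized kernels and the pointwise estimate\<close>

text \<open>The reproducing kernel at \<open>w\<close>, normalized.\<close>

definition fock_kernel :: "real \<Rightarrow> complex \<Rightarrow> complex \<Rightarrow> complex" where
  "fock_kernel \<alpha> w = fock_translation \<alpha> w (fock_basis \<alpha> 0)"

lemma fock_kernel_in_fock_space: "0 < \<alpha> \<Longrightarrow> fock_kernel \<alpha> w \<in> fock_space \<alpha>"
  unfolding fock_kernel_def by (intro fock_translation_in_fock_space fock_basis_in_fock_space)

lemma fock_norm_sq_kernel: "0 < \<alpha> \<Longrightarrow> fock_norm_sq \<alpha> (fock_kernel \<alpha> w) = 1"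
  unfolding fock_kernel_def
  using fock_norm_sq_translation[OF fock_basis_in_fock_space[of \<alpha> 0]] integral_power_cmod_gauss[of \<alpha> 0]
  by (simp add: fock_norm_sq_def cmod_fock_basis_sq)

lemma fock_kernel_diagonal:
  "0 < \<alpha> \<Longrightarrow> (cmod (fock_kernel \<alpha> w w))\<^sup>2 * exp (- \<alpha> * (cmod w)\<^sup>2) = 1"
  unfolding fock_kernel_def fock_translation_weighted by (simp add: fock_basis_def)

text \<open>The kernel translated by \<open>- l\<close> is the exponential
  \<open>C * exp (u * z)\<close>, so its coefficients are explicit. The modulus of \<open>C\<close>
  yields the factor \<open>exp (- t)\<close> and that of \<open>u\<close> the powers of
  \<open>t\<close>, with \<open>t\<close> the Poisson mean.\<close>

lemma fock_inner_kernel: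
  assumes \<alpha>: "0 < \<alpha>"
  shows "(cmod (fock_inner \<alpha> (fock_kernel \<alpha> w) (fock_translation \<alpha> l (fock_basis \<alpha> k))))\<^sup>2
    = poisson_weight (\<alpha> * (dist w l)\<^sup>2) k"
proof -
  let ?g = "fock_translation \<alpha> (- l) (fock_kernel \<alpha> w)"
  define C where "C = exp (of_real \<alpha> * cnj w * l - of_real (\<alpha> / 2 * (cmod w)\<^sup>2) - of_real (\<alpha> / 2 * (cmod l)\<^sup>2))"
  define u where "u = of_real \<alpha> * cnj (w - l)"
  have g: "?g \<in> fock_space \<alpha>"
    by (intro fock_translation_in_fock_space fock_kernel_in_fock_space \<alpha>)
  have "?g z = C * exp (u * z)" for z
    unfolding fock_kernel_def fock_translation_def fock_basis_def C_def u_def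
    by (simp add: mult_exp_exp algebra_simps)
  moreover have "(\<lambda>j. (C * u ^ j / fact j) * z ^ j) sums (C * exp (u * z))" for z
  proof -
    have "(\<lambda>j. C * ((u * z) ^ j /\<^sub>R fact j)) sums (C * exp (u * z))"
      by (intro sums_mult exp_converges)
    then show ?thesis
      by (simp add: power_mult_distrib scaleR_conv_of_real field_simps)
  qed
  ultimately have "fock_inner \<alpha> ?g (fock_basis \<alpha> k) = C * u ^ k / fact k * of_real (sqrt (fact k / \<alpha> ^ k))"
    by (intro fock_inner_basis[OF \<alpha> g]) simp
  then have "(cmod (fock_inner \<alpha> ?g (fock_basis \<alpha> k)))\<^sup>2
      = (cmod C)\<^sup>2 * ((cmod u)\<^sup>2) ^ k / (fact k)\<^sup>2 * (fact k / \<alpha> ^ k)"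
    using \<alpha> by (simp add: norm_mult norm_divide norm_power power_mult_distrib power_divide flip: power_mult)
      (simp add: mult.commute)
  also have "(cmod u)\<^sup>2 = \<alpha> * (\<alpha> * (dist w l)\<^sup>2)"
    using \<alpha> by (simp add: u_def norm_mult dist_norm power2_eq_square complex_mod_cnj del: complex_cnj_diff)
  also have "(cmod C)\<^sup>2 = exp (- (\<alpha> * (dist w l)\<^sup>2))"
  proof -
    have "(cmod C)\<^sup>2 = exp (2 * (\<alpha> * (Re w * Re l + Im w * Im l) - \<alpha> / 2 * (cmod w)\<^sup>2 - \<alpha> / 2 * (cmod l)\<^sup>2))"
      unfolding exp_double by (simp add: C_def algebra_simps)
    also have "2 * (\<alpha> * (Re w * Re l + Im w * Im l) - \<alpha> / 2 * (cmod w)\<^sup>2 - \<alpha> / 2 * (cmod l)\<^sup>2)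
        = - (\<alpha> * (dist w l)\<^sup>2)"
      unfolding dist_norm cmod_power2 by (simp add: power2_eq_square algebra_simps)
    finally show ?thesis .
  qed
  also have "exp (- (\<alpha> * (dist w l)\<^sup>2)) * (\<alpha> * (\<alpha> * (dist w l)\<^sup>2)) ^ k / (fact k)\<^sup>2 * (fact k / \<alpha> ^ k)
      = poisson_weight (\<alpha> * (dist w l)\<^sup>2) k"
  proof -
    define t where "t = \<alpha> * (dist w l)\<^sup>2"
    show ?thesis unfolding t_def[symmetric] poisson_weight_def
      using \<alpha> by (simp add: power_mult_distrib[of \<alpha> t] power2_eq_square)
  qed
  finally show ?thesis
    unfolding fock_inner_translation_right[OF fock_kernel_in_fock_space[OF \<alpha>] fock_basis_in_fock_space[OF \<alpha>]] .
qed

lemma fock_quotient_norm_sq_kernel: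
  "0 < \<alpha> \<Longrightarrow> fock_quotient_norm_sq \<alpha> l n (fock_kernel \<alpha> w) = sum (poisson_weight (\<alpha> * (dist w l)\<^sup>2)) {..<n}"
  unfolding fock_quotient_norm_sq_def by (simp add: fock_inner_kernel)

text \<open>A function orthogonal to the first \<open>m\<close> basis functions at \<open>l\<close>
  is small at depth \<open>K\<close> inside the disc of \<open>l\<close>. Translation of
  \<open>l\<close> to 0 reduces this to the upper Poisson tail.\<close>

lemma fock_point_estimate:
  assumes \<alpha>: "0 < \<alpha>" and f: "f \<in> fock_space \<alpha>" and K: "0 < K"
    and orth: "\<And>k. k < m \<Longrightarrow> fock_inner \<alpha> f (fock_translation \<alpha> l (fock_basis \<alpha> k)) = 0"
    and w: "dist w l + K \<le> sqrt (real m / \<alpha>)"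
  shows "(cmod (f w))\<^sup>2 * exp (- \<alpha> * (cmod w)\<^sup>2) \<le> fock_norm_sq \<alpha> f * exp (- (\<alpha> * K\<^sup>2 / 4))"
proof -
  let ?g = "fock_translation \<alpha> (- l) f"
  have "(cmod (?g (w - l)))\<^sup>2 * exp (- \<alpha> * (cmod (w - l))\<^sup>2) \<le> fock_norm_sq \<alpha> ?g * exp (- (\<alpha> * K\<^sup>2 / 4))"
  proof (rule fock_point_estimate_of_orthogonal[OF \<alpha> fock_translation_in_fock_space[OF f]])
    show "fock_inner \<alpha> ?g (fock_basis \<alpha> k) = 0" if "k < m" for k
      using orth[OF that] fock_inner_translation_right[OF f fock_basis_in_fock_space[OF \<alpha>]] by simp
    show "sum (poisson_weight (\<alpha> * (cmod (w - l))\<^sup>2)) {m..<N} \<le> exp (- (\<alpha> * K\<^sup>2 / 4))" for N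
      using w by (intro poisson_upper_tail[OF \<alpha> K]) (auto simp: dist_norm)
  qed
  then show ?thesis
    unfolding fock_translation_weighted fock_norm_sq_translation[OF f] by simp
qed

section \<open>Sampling and interpolating divisors\<close>

lemma exists_point_within_both:
  fixes x y :: complex
  assumes "0 \<le> a" "0 \<le> b" "dist x y \<le> a + b"
  shows "\<exists>w. dist w x \<le> a \<and> dist w y \<le> b"
proof (cases "dist x y \<le> a")
  case True
  then show ?thesis using assms by (intro exI[of _ y]) (simp add: dist_commute)
next
  case False
  define d where "d = dist x y"
  have d: "0 \<le> a" "a < d" using False assms by (auto simp: d_def)
  define w where "w = x + (a / d) *\<^sub>R (y - x)"
  have dn: "cmod (y - x) = d" "cmod (x - y) = d" by (simp_all add: d_def dist_norm norm_minus_commute)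
  then have "dist w x = \<bar>a / d\<bar> * d" by (simp add: w_def dist_norm)
  then have "dist w x = a" using d by simp
  have "w - y = (1 - a / d) *\<^sub>R (x - y)" by (simp add: w_def algebra_simps)
  then have "dist w y = \<bar>1 - a / d\<bar> * d" by (simp add: dist_norm dn)
  moreover have "a / d \<le> 1" using d by simp
  ultimately have "dist w y = d - a" using d by (simp add: left_diff_distrib)
  with \<open>dist w x = a\<close> show ?thesis using assms by (intro exI[of _ w]) (simp add: d_def)
qed

text \<open>For an uncovered \<open>p\<close>, every quotient norm of the kernel at \<open>p\<close>
  is at most \<epsilon> times one of those of the kernels at four points near \<open>p\<close>.
  Summed over \<Lambda>, the lower sampling bound at \<open>p\<close> and the upper bounds at the
  four points give \<open>c \<le> \<epsilon> * (4 * C)\<close>, which fails for large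
  \<open>K\<close>.\<close>

lemma fock_sampling_cover:
  assumes \<alpha>: "0 < \<alpha>" and c: "0 < c" and K: "0 < K" and big: "40 * C / c < \<alpha> * K\<^sup>2"
    and samp: "\<And>f. f \<in> fock_space \<alpha> \<Longrightarrow> (\<lambda>l. fock_quotient_norm_sq \<alpha> l (m l) f) summable_on \<Lambda> \<and>
          c * fock_norm_sq \<alpha> f \<le> (\<Sum>\<^sub>\<infinity>l\<in>\<Lambda>. fock_quotient_norm_sq \<alpha> l (m l) f) \<and>
          (\<Sum>\<^sub>\<infinity>l\<in>\<Lambda>. fock_quotient_norm_sq \<alpha> l (m l) f) \<le> C * fock_norm_sq \<alpha> f"
  shows "\<exists>l\<in>\<Lambda>. dist p l \<le> sqrt (real (m l) / \<alpha>) + K"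
proof (rule ccontr)
  assume "\<not> ?thesis"
  then have far: "sqrt (real (m l) / \<alpha>) + K < dist p l" if "l \<in> \<Lambda>" for l using that by force
  define Q where "Q = (\<lambda>w l. sum (poisson_weight (\<alpha> * (dist w l)\<^sup>2)) {..<m l})"
  define q where "q = (\<lambda>j::nat. p + of_real (K / 2) * \<i> ^ j)"
  define \<epsilon> where "\<epsilon> = exp (- (\<alpha> * K\<^sup>2 / 10))"
  have Q0: "0 \<le> Q w l" for w l
    unfolding Q_def using \<alpha> by (intro sum_nonneg poisson_weight_nonneg) auto
  have Qsamp: "Q w summable_on \<Lambda> \<and> c \<le> infsum (Q w) \<Lambda> \<and> infsum (Q w) \<Lambda> \<le> C" for w
    using samp[OF fock_kernel_in_fock_space[OF \<alpha>, of w]] \<alpha>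
    by (simp add: fock_quotient_norm_sq_kernel fock_norm_sq_kernel Q_def[abs_def])
  have pt: "Q p l \<le> \<epsilon> * (\<Sum>j<4. Q (q j) l)" if l: "l \<in> \<Lambda>" for l
  proof -
    have r0: "0 \<le> sqrt (real (m l) / \<alpha>)" using \<alpha> by simp
    then have "K \<le> dist p l" using far[OF l] by linarith
    then obtain j where j: "j \<in> {..<4}" "dist (q j) l + K / 5 \<le> dist p l"
      using quarter_turn_step_towards[OF K] unfolding q_def by blast
    \<comment> \<open>The step has length \<open>K / 2\<close>, so \<open>q j\<close> is still
      outside the disc by \<open>K / 2\<close>, the margin of the lower tail estimate.\<close>
    have "dist p l \<le> dist p (q j) + dist (q j) l" by (rule dist_triangle)
    moreover have "dist p (q j) = K / 2" using K by (simp add: q_def dist_norm norm_mult norm_power)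
    ultimately have "sqrt (real (m l) / \<alpha>) + K / 2 \<le> dist (q j) l" using far[OF l] by linarith
    then have "Q p l \<le> \<epsilon> * Q (q j) l"
      unfolding Q_def \<epsilon>_def using j(2) by (intro poisson_lower_tail[OF \<alpha> K])
    also have "Q (q j) l \<le> (\<Sum>j<4. Q (q j) l)"
      by (rule member_le_sum[OF j(1)]) (use Q0 in auto)
    finally show ?thesis by (simp add: \<epsilon>_def)
  qed
  have sums: "((\<lambda>l. \<Sum>j<4. Q (q j) l) has_sum (\<Sum>j<4. infsum (Q (q j)) \<Lambda>)) \<Lambda>"
    using Qsamp by (auto simp: eval_nat_numeral intro!: has_sum_add has_sum_infsum)
  then have sums': "((\<lambda>l. \<epsilon> * (\<Sum>j<4. Q (q j) l)) has_sum (\<epsilon> * (\<Sum>j<4. infsum (Q (q j)) \<Lambda>))) \<Lambda>"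
    by (rule has_sum_cmult_right)
  have "infsum (Q p) \<Lambda> \<le> \<epsilon> * (\<Sum>j<4. infsum (Q (q j)) \<Lambda>)"
    by (rule has_sum_mono[OF has_sum_infsum sums']) (use Qsamp pt in auto)
  also have "\<dots> \<le> \<epsilon> * (\<Sum>j<4::nat. C)"
    by (intro mult_left_mono sum_mono) (use Qsamp in \<open>auto simp: \<epsilon>_def\<close>)
  finally have "c \<le> \<epsilon> * (4 * C)" using Qsamp[of p] by simp
  \<comment> \<open>The estimate of \<open>x\<close> by \<open>exp x\<close> suffices; its factor 10
    and the four points make up the 40 in \<open>big\<close>.\<close>
  moreover have "\<epsilon> * (\<alpha> * K\<^sup>2 / 10) \<le> 1"
  proof -
    have "\<alpha> * K\<^sup>2 / 10 \<le> exp (\<alpha> * K\<^sup>2 / 10)" using exp_ge_add_one_self[of "\<alpha> * K\<^sup>2 / 10"] by linarith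
    then show ?thesis by (simp add: \<epsilon>_def exp_minus field_simps)
  qed
  moreover have "40 * C < c * (\<alpha> * K\<^sup>2)" using big c by (simp add: field_simps)
  then have "\<epsilon> * (40 * C) < \<epsilon> * (c * (\<alpha> * K\<^sup>2))" by (intro mult_strict_left_mono) (auto simp: \<epsilon>_def)
  moreover have "c * (\<epsilon> * (\<alpha> * K\<^sup>2 / 10)) \<le> c * 1" by (intro mult_left_mono calculation(2)) (use c in auto)
  ultimately show False by (simp add: algebra_simps)
qed

text \<open>Let \<open>f\<close> interpolate the data of the kernel \<open>k\<close> at
  \<open>l\<close> and zero elsewhere. At a common deep point \<open>w\<close>, \<open>f\<close> is
  small because of \<open>l'\<close> and \<open>f - k\<close> is small because of \<open>l\<close>,
  although \<open>k\<close> has weighted modulus 1 there. The lower sampling bound keeps the norm of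
  \<open>f\<close> under control.\<close>

lemma fock_interpolating_sampling_separated:
  assumes \<alpha>: "0 < \<alpha>" and c: "0 < c" and K: "0 < K" and big: "6 / c + 4 < \<alpha> * K\<^sup>2 / 4"
    and samp: "\<And>f. f \<in> fock_space \<alpha> \<Longrightarrow> (\<lambda>l. fock_quotient_norm_sq \<alpha> l (m l) f) summable_on \<Lambda> \<and>
          c * fock_norm_sq \<alpha> f \<le> (\<Sum>\<^sub>\<infinity>l\<in>\<Lambda>. fock_quotient_norm_sq \<alpha> l (m l) f)"
    and interp: "fock_interpolating \<alpha> \<Lambda> m"
    and l: "l \<in> \<Lambda>" "l' \<in> \<Lambda>" "l \<noteq> l'"
    and r: "K \<le> sqrt (real (m l) / \<alpha>)" "K \<le> sqrt (real (m l') / \<alpha>)"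
  shows "sqrt (real (m l) / \<alpha>) + sqrt (real (m l') / \<alpha>) - 2 * K \<le> dist l l'"
proof (rule ccontr)
  assume "\<not> ?thesis"
  \<comment> \<open>Radii of at least \<open>K\<close> keep the shrunk radii nonnegative, so
    overlapping shrunk discs have a common point.\<close>
  then obtain w where w: "dist w l \<le> sqrt (real (m l) / \<alpha>) - K" "dist w l' \<le> sqrt (real (m l') / \<alpha>) - K"
    using exists_point_within_both[of "sqrt (real (m l) / \<alpha>) - K" "sqrt (real (m l') / \<alpha>) - K" l l'] r
    by auto
  define k where "k = fock_kernel \<alpha> w"
  have k: "k \<in> fock_space \<alpha>" unfolding k_def by (rule fock_kernel_in_fock_space[OF \<alpha>])
  define S where "S = fock_quotient_norm_sq \<alpha> l (m l) k"
  \<comment> \<open>The data vanish at every point other than \<open>l\<close>, not only at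
    \<open>l'\<close>, so that the sampling sum of \<open>f\<close> reduces to the single term
    \<open>S\<close>.\<close>
  define v where "v = (\<lambda>x j. if x = l then fock_inner \<alpha> k (fock_translation \<alpha> l (fock_basis \<alpha> j)) else 0)"
  have vsum: "(\<Sum>j<m x. (cmod (v x j))\<^sup>2) = (if x = l then S else 0)" for x
    by (simp add: v_def S_def fock_quotient_norm_sq_def)
  have hs: "((\<lambda>x. if x = l then S else 0) has_sum S) \<Lambda>"
    by (rule has_sum_finite_neutralI[of "{l}"]) (use l in auto)
  have "(\<lambda>x. \<Sum>j<m x. (cmod (v x j))\<^sup>2) summable_on \<Lambda>"
    unfolding vsum using hs has_sum_imp_summable by blast
  then obtain f where f: "f \<in> fock_space \<alpha>"
    and fv: "\<And>x j. x \<in> \<Lambda> \<Longrightarrow> j < m x \<Longrightarrow> fock_inner \<alpha> f (fock_translation \<alpha> x (fock_basis \<alpha> j)) = v x j"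
    using interp unfolding fock_interpolating_def by blast
  have "fock_quotient_norm_sq \<alpha> x (m x) f = (if x = l then S else 0)" if "x \<in> \<Lambda>" for x
    unfolding fock_quotient_norm_sq_def vsum[symmetric] using fv[OF that] by simp
  then have "(\<Sum>\<^sub>\<infinity>x\<in>\<Lambda>. fock_quotient_norm_sq \<alpha> x (m x) f) = (\<Sum>\<^sub>\<infinity>x\<in>\<Lambda>. if x = l then S else 0)"
    by (rule infsum_cong)
  also have "\<dots> = S" using hs by (rule infsumI)
  also have "S \<le> 1"
    unfolding S_def k_def fock_quotient_norm_sq_kernel[OF \<alpha>]
    using \<alpha> by (intro sum_poisson_weight_le_1) auto
  finally have "c * fock_norm_sq \<alpha> f \<le> 1" using samp[OF f] by linarith
  then have nf: "fock_norm_sq \<alpha> f \<le> 1 / c" using c by (simp add: field_simps)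
  define \<delta> where "\<delta> = exp (- (\<alpha> * K\<^sup>2 / 4))"
  have \<delta>0: "0 < \<delta>" by (simp add: \<delta>_def)
  let ?w = "exp (- \<alpha> * (cmod w)\<^sup>2)"
  have "(cmod (f w))\<^sup>2 * ?w \<le> fock_norm_sq \<alpha> f * \<delta>"
    unfolding \<delta>_def
    by (rule fock_point_estimate[OF \<alpha> f K, of "m l'" l']) (use fv l w in \<open>auto simp: v_def\<close>)
  also have "\<dots> \<le> (1 / c) * \<delta>" using nf \<delta>0 by (intro mult_right_mono) auto
  finally have 1: "(cmod (f w))\<^sup>2 * ?w \<le> (1 / c) * \<delta>" .
  have "(cmod (f w - k w))\<^sup>2 * ?w \<le> fock_norm_sq \<alpha> (\<lambda>z. f z - k z) * \<delta>"
    unfolding \<delta>_def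
  proof (rule fock_point_estimate[OF \<alpha> fock_space_diff[OF f k] K, of "m l" l])
    show "fock_inner \<alpha> (\<lambda>z. f z - k z) (fock_translation \<alpha> l (fock_basis \<alpha> j)) = 0" if "j < m l" for j
      using fock_inner_diff_left[OF f k fock_translation_in_fock_space[OF fock_basis_in_fock_space[OF \<alpha>]]]
        fv[OF l(1) that] by (simp add: v_def)
  qed (use w in simp)
  also have "\<dots> \<le> (2 * (1 / c) + 2) * \<delta>"
    using fock_norm_sq_diff_le[OF \<alpha> f k] nf fock_norm_sq_kernel[OF \<alpha>, of w] \<delta>0
    by (intro mult_right_mono) (auto simp: k_def)
  finally have 2: "(cmod (f w - k w))\<^sup>2 * ?w \<le> (2 * (1 / c) + 2) * \<delta>" .
  have "cmod (k w) \<le> cmod (f w) + cmod (f w - k w)"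
    by (metis norm_minus_commute norm_triangle_sub)
  then have "(cmod (k w))\<^sup>2 \<le> (cmod (f w) + cmod (f w - k w))\<^sup>2" by (intro power_mono) auto
  also have "\<dots> \<le> 2 * (cmod (f w))\<^sup>2 + 2 * (cmod (f w - k w))\<^sup>2"
    using sum_squares_bound[of "cmod (f w)" "cmod (f w - k w)"] by (simp add: power2_sum)
  finally have "(cmod (k w))\<^sup>2 * ?w \<le> (2 * (cmod (f w))\<^sup>2 + 2 * (cmod (f w - k w))\<^sup>2) * ?w"
    by (rule mult_right_mono) simp
  then have "1 \<le> 2 * ((cmod (f w))\<^sup>2 * ?w) + 2 * ((cmod (f w - k w))\<^sup>2 * ?w)"
    using fock_kernel_diagonal[OF \<alpha>, of w] by (simp only: k_def distrib_right mult.assoc)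
  also have "\<dots> \<le> 2 * ((1 / c) * \<delta>) + 2 * ((2 * (1 / c) + 2) * \<delta>)"
    using 1 2 by linarith
  \<comment> \<open>The constant is \<open>2 / c\<close> from \<open>f\<close> and
    \<open>4 / c + 4\<close> from \<open>f - k\<close>, each after doubling the square.\<close>
  also have "\<dots> = (6 / c + 4) * \<delta>" by (simp add: algebra_simps)
  also have "\<dots> < \<alpha> * K\<^sup>2 / 4 * \<delta>" using big \<delta>0 by (rule mult_strict_right_mono)
  also have "\<dots> \<le> 1"
  proof -
    have "\<alpha> * K\<^sup>2 / 4 \<le> exp (\<alpha> * K\<^sup>2 / 4)" using exp_ge_add_one_self[of "\<alpha> * K\<^sup>2 / 4"] by linarith
    then show ?thesis by (simp add: \<delta>_def exp_minus field_simps)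
  qed
  finally show False by simp
qed

text \<open>Since multiplicities are at least 1, each point of the ball contributes at least the
  Poisson weight at index 0, hence at least \<open>exp (- (\<alpha> * R\<^sup>2))\<close>, to a
  convergent sum for the kernel at 0.\<close>

lemma fock_sampling_finite_in_cball:
  assumes \<alpha>: "0 < \<alpha>" and m1: "\<And>l. l \<in> \<Lambda> \<Longrightarrow> 1 \<le> m l"
    and sm: "(\<lambda>l. fock_quotient_norm_sq \<alpha> l (m l) (fock_kernel \<alpha> 0)) summable_on \<Lambda>"
  shows "finite {l\<in>\<Lambda>. cmod l \<le> R}"
proof -
  define Q where "Q = (\<lambda>l. fock_quotient_norm_sq \<alpha> l (m l) (fock_kernel \<alpha> 0))"
  define \<epsilon> where "\<epsilon> = exp (- (\<alpha> * R\<^sup>2))"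
  have Q: "Q l = sum (poisson_weight (\<alpha> * (cmod l)\<^sup>2)) {..<m l}" for l
    using fock_quotient_norm_sq_kernel[OF \<alpha>] by (simp add: Q_def)
  have Qlow: "\<epsilon> \<le> Q l" if "l \<in> {l\<in>\<Lambda>. cmod l \<le> R}" for l
  proof -
    have "(cmod l)\<^sup>2 \<le> R\<^sup>2" using that by (intro power_mono) auto
    then have "\<epsilon> \<le> poisson_weight (\<alpha> * (cmod l)\<^sup>2) 0"
      using \<alpha> by (simp add: \<epsilon>_def poisson_weight_def)
    also have "\<dots> \<le> Q l" unfolding Q
      using m1[of l] that \<alpha> by (intro member_le_sum poisson_weight_nonneg) auto
    finally show ?thesis .
  qed
  have Q0: "0 \<le> Q l" for l
    unfolding Q using \<alpha> by (intro sum_nonneg poisson_weight_nonneg) auto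
  have "card G \<le> nat \<lfloor>infsum Q \<Lambda> / \<epsilon>\<rfloor>" if G: "G \<subseteq> {l\<in>\<Lambda>. cmod l \<le> R}" "finite G" for G
  proof -
    have "real (card G) * \<epsilon> = (\<Sum>l\<in>G. \<epsilon>)" by simp
    also have "\<dots> \<le> sum Q G" using Qlow G by (intro sum_mono) blast
    also have "\<dots> \<le> infsum Q \<Lambda>"
      by (rule finite_sum_le_infsum) (use G sm Q0 in \<open>auto simp: Q_def\<close>)
    finally have "real (card G) \<le> infsum Q \<Lambda> / \<epsilon>" by (simp add: \<epsilon>_def field_simps)
    then show ?thesis by (simp add: le_nat_floor)
  qed
  then show ?thesis using finite_if_finite_subsets_card_bdd by blast
qed

theorem corollary1p4:
  fixes \<alpha> :: real and \<Lambda> :: "complex set" and m :: "complex \<Rightarrow> nat"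
  assumes "\<alpha> > 0"
    and "divisor \<Lambda> m"
    and "\<forall>M::nat. \<exists>R::real. \<forall>l\<in>\<Lambda>. cmod l > R \<longrightarrow> m l > M"
  shows "\<not> (fock_interpolating \<alpha> \<Lambda> m \<and> fock_sampling \<alpha> \<Lambda> m)"
proof
  assume "fock_interpolating \<alpha> \<Lambda> m \<and> fock_sampling \<alpha> \<Lambda> m"
  then obtain c C where interp: "fock_interpolating \<alpha> \<Lambda> m" and c: "0 < c" "c \<le> C"
    and samp: "\<And>f. f \<in> fock_space \<alpha> \<Longrightarrow> (\<lambda>l. fock_quotient_norm_sq \<alpha> l (m l) f) summable_on \<Lambda> \<and>
          c * fock_norm_sq \<alpha> f \<le> (\<Sum>\<^sub>\<infinity>l\<in>\<Lambda>. fock_quotient_norm_sq \<alpha> l (m l) f) \<and>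
          (\<Sum>\<^sub>\<infinity>l\<in>\<Lambda>. fock_quotient_norm_sq \<alpha> l (m l) f) \<le> C * fock_norm_sq \<alpha> f"
    unfolding fock_sampling_def by blast
  define r where "r = (\<lambda>l. sqrt (real (m l) / \<alpha>))"
  \<comment> \<open>The summand \<open>40 * C / c\<close> serves covering. The summands
    \<open>24 / c + 17\<close> exceed four times \<open>6 / c + 4\<close>, as separation
    demands.\<close>
  define B where "B = 40 * C / c + 24 / c + 17"
  \<comment> \<open>The summand 1 ensures \<open>K < K\<^sup>2\<close>, so that
    \<open>B < \<alpha> * K\<close> passes to the square.\<close>
  define K where "K = 1 + B / \<alpha>"
  have B: "0 < B" using c by (simp add: B_def add_pos_pos)
  have K: "1 < K" using B assms(1) by (simp add: K_def)
  have "B < \<alpha> * K" using assms(1) by (simp add: K_def field_simps)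
  also have "\<alpha> * K \<le> \<alpha> * K\<^sup>2" using assms(1) K by (simp add: power2_eq_square)
  finally have BK: "B < \<alpha> * K\<^sup>2" .
  have "0 \<le> 40 * C / c" "0 \<le> 24 / c" using c by auto
  then have big: "40 * C / c < \<alpha> * K\<^sup>2" "6 / c + 4 < \<alpha> * K\<^sup>2 / 4"
    using BK unfolding B_def by linarith+
  show False
  proof (rule no_large_disc_tiling[of K \<Lambda> r])
    show "\<exists>l\<in>\<Lambda>. dist p l \<le> r l + K" for p
      unfolding r_def using K by (intro fock_sampling_cover[OF assms(1) c(1) _ big(1) samp]) auto
    show "r l + r l' - 2 * K \<le> dist l l'"
      if "l \<in> \<Lambda>" "l' \<in> \<Lambda>" "l \<noteq> l'" "K \<le> r l" "K \<le> r l'" for l l'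
      unfolding r_def
      by (rule fock_interpolating_sampling_separated[OF assms(1) c(1) _ big(2) _ interp])
         (use K samp that in \<open>auto simp: r_def\<close>)
    show "finite {l\<in>\<Lambda>. r l \<le> \<rho>}" for \<rho>
    proof -
      \<comment> \<open>A radius of at most \<rho> means a multiplicity of at most
        \<open>\<alpha> * \<rho>\<^sup>2\<close>, which growth confines to a ball; sampling leaves
        finitely many points there.\<close>
      obtain R where R: "\<And>l. l \<in> \<Lambda> \<Longrightarrow> cmod l > R \<Longrightarrow> m l > nat \<lceil>\<alpha> * \<rho>\<^sup>2\<rceil>"
        using assms(3) by blast
      have "{l\<in>\<Lambda>. r l \<le> \<rho>} \<subseteq> {l\<in>\<Lambda>. cmod l \<le> R}"
      proof safe
        fix l assume l: "l \<in> \<Lambda>" "r l \<le> \<rho>"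
        have "(r l)\<^sup>2 \<le> \<rho>\<^sup>2" using l(2) assms(1) by (intro power_mono) (auto simp: r_def)
        then have "real (m l) \<le> \<alpha> * \<rho>\<^sup>2" using assms(1) by (simp add: r_def field_simps)
        then have "m l \<le> nat \<lceil>\<alpha> * \<rho>\<^sup>2\<rceil>" by linarith
        then show "cmod l \<le> R" using R[OF l(1)] by force
      qed
      moreover have "finite {l\<in>\<Lambda>. cmod l \<le> R}"
        using samp[OF fock_kernel_in_fock_space[OF assms(1)]] assms(1,2)
        by (intro fock_sampling_finite_in_cball[where m=m and \<alpha>=\<alpha>]) (auto simp: divisor_def)
      ultimately show ?thesis by (rule finite_subset)
    qed
  qed (use K assms(1) in \<open>auto simp: r_def\<close>)
qed

end
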